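(* Let $E$ be a complex separable Hilbert space carrying a unitary representation of the dihedral group $D_n$ with generators $\mathcal R,\mathcal S$. Let $\widetilde{\mathcal A}$ be a bounded selfadjoint essentially positive Fredholm operator on $E$, let $\mathcal K$ be a compact symmetric bounded linear operator on $E$, and assume that the path $\lambda\mapsto\widetilde{\mathcal A}_\lambda=\widetilde{\mathcal A}+\lambda\mathcal K$, $\lambda\in[0,1]$, is $D_n$-equivariant (each $\widetilde{\mathcal A}_\lambda$ commutes with $\mathcal R$ and $\mathcal S$). Then for every $h\in\{0,\dots,n-1\}$ $$\mathrm n_-(\widetilde{\mathcal A})=\mathrm n_-(\widetilde{\mathcal A}|_{E_h^+})+\mathrm n_-(\widetilde{\mathcal A}|_{E_h^-}),$$ and, for each choice of sign, $$\mathrm n_-(\widetilde{\mathcal A}|_{E_h^\pm})=\sum_{k=0}^{\bar n}\mathrm n_-(\widetilde{\mathcal A}|_{F_{k,h}^\pm}).$$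
   Context: $n\ge 1$ is an integer. The unitary representation of $D_n$ in $E$ is given by unitary operators $\mathcal R,\mathcal S$ on $E$ with $\mathcal R^n=\mathcal S^2=(\mathcal S\mathcal R)^2=\mathrm{Id}_E$. Let $\zeta_n=e^{2\pi i/n}$ and $E_k=\ker(\mathcal R-\zeta_n^k\mathrm{Id}_E)$ for $k\in\mathbb Z$. Let $\bar n=\lfloor n/2\rfloor$. Define $F_0=E_0$; $F_k=E_k\oplus E_{-k}$ for $1\le k\le\lfloor (n-1)/2\rfloor$; and, if $n$ is even, $F_{n/2}=E_{n/2}$. For $h\in\{0,\dots,n-1\}$ put $E_h^\pm=\{x\in E: \mathcal S\mathcal R^h x=\pm x\}$ and $F_{k,h}^\pm=\{u\in F_k:\mathcal S\mathcal R^h u=\pm u\}$. A selfadjoint Fredholm operator is essentially positive if its essential spectrum is contained in $(0,+\infty)$. The Morse index $\mathrm n_-(T)$ of such an operator is the (finite) dimension of its negative spectral subspace. *)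

theory Defs
  imports "HOL-Analysis.Analysis"
begin

text \<open>
  Complex inner product spaces, on top of the real normed spaces of the library; the inner
  product is linear in its first argument.
\<close>

class complex_inner = real_normed_vector +
  fixes scaleC :: "complex \<Rightarrow> 'a \<Rightarrow> 'a"  (infixr "*\<^sub>C" 75)
    and cinner :: "'a \<Rightarrow> 'a \<Rightarrow> complex"
  assumes scaleC_add_right: "c *\<^sub>C (x + y) = c *\<^sub>C x + c *\<^sub>C y"
    and scaleC_add_left: "(c + d) *\<^sub>C x = c *\<^sub>C x + d *\<^sub>C x"
    and scaleC_scaleC: "c *\<^sub>C d *\<^sub>C x = (c * d) *\<^sub>C x"
    and scaleR_scaleC: "r *\<^sub>R x = complex_of_real r *\<^sub>C x"
    and cinner_commute: "cinner x y = cnj (cinner y x)"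
    and cinner_add_left: "cinner (x + y) z = cinner x z + cinner y z"
    and cinner_scaleC_left: "cinner (c *\<^sub>C x) y = c * cinner x y"
    and cinner_self: "cinner x x = complex_of_real ((norm x)\<^sup>2)"

class chilbert_space = complex_inner + banach

global_interpretation complex_vector: vector_space "scaleC :: complex \<Rightarrow> 'a::complex_inner \<Rightarrow> 'a"
proof
  show "1 *\<^sub>C x = x" for x :: 'a
    using scaleR_scaleC[of 1 x] by simp
qed (simp_all add: scaleC_add_right scaleC_add_left scaleC_scaleC)

definition fin_dim :: "'a::complex_inner set \<Rightarrow> bool" where
  "fin_dim V \<longleftrightarrow> (\<exists>B. finite B \<and> V \<subseteq> complex_vector.span B)"

definition bounded_clinear :: "('a::complex_inner \<Rightarrow> 'a) \<Rightarrow> bool" where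
  "bounded_clinear T \<longleftrightarrow> bounded_linear T \<and> (\<forall>c x. T (c *\<^sub>C x) = c *\<^sub>C T x)"

definition selfadjoint :: "('a::complex_inner \<Rightarrow> 'a) \<Rightarrow> bool" where
  "selfadjoint T \<longleftrightarrow> bounded_clinear T \<and> (\<forall>x y. cinner (T x) y = cinner x (T y))"

definition unitary :: "('a::complex_inner \<Rightarrow> 'a) \<Rightarrow> bool" where
  "unitary U \<longleftrightarrow> bounded_clinear U \<and> surj U \<and> (\<forall>x y. cinner (U x) (U y) = cinner x y)"

definition compact_operator :: "('a::complex_inner \<Rightarrow> 'a) \<Rightarrow> bool" where
  "compact_operator K \<longleftrightarrow> bounded_clinear K \<and> (\<forall>X. bounded X \<longrightarrow> compact (closure (K ` X)))"

definition fredholm :: "('a::complex_inner \<Rightarrow> 'a) \<Rightarrow> bool" where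
  "fredholm T \<longleftrightarrow> bounded_clinear T \<and> fin_dim {x. T x = 0} \<and> closed (range T)
     \<and> (\<exists>B. finite B \<and> complex_vector.span (range T \<union> B) = UNIV)"

definition essential_spectrum :: "('a::complex_inner \<Rightarrow> 'a) \<Rightarrow> complex set" where
  "essential_spectrum T = {z. \<not> fredholm (\<lambda>x. T x - z *\<^sub>C x)}"

definition essentially_positive :: "('a::complex_inner \<Rightarrow> 'a) \<Rightarrow> bool" where
  "essentially_positive T \<longleftrightarrow>
     selfadjoint T \<and> fredholm T \<and> essential_spectrum T \<subseteq> complex_of_real ` {0<..}"

text \<open>
  A restriction \<open>T|V\<close> to a closed \<open>T\<close>-invariant subspace \<open>V\<close> is represented by the pair of \<open>V\<close> and
  \<open>T\<close>. The bound in the definition of the spectrum says that the inverse of \<open>T|V - z\<close> is bounded.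
\<close>

definition op_spectrum :: "'a::complex_inner set \<Rightarrow> ('a \<Rightarrow> 'a) \<Rightarrow> complex set" where
  "op_spectrum V T = {z. \<not> (bij_betw (\<lambda>x. T x - z *\<^sub>C x) V V
     \<and> (\<exists>C. \<forall>x\<in>V. norm x \<le> C * norm (T x - z *\<^sub>C x)))}"

definition orth_in :: "'a::complex_inner set \<Rightarrow> 'a set \<Rightarrow> 'a set" where
  "orth_in V M = {x\<in>V. \<forall>y\<in>M. cinner x y = 0}"

text \<open>
  The spectral subspace of a selfadjoint \<open>T|V\<close> belonging to the part of its spectrum in \<open>Z\<close>, through
  the orthogonal splitting of \<open>V\<close> that separates the spectrum along \<open>Z\<close>. When this part is open and
  closed in the spectrum, there is exactly one such splitting, and \<open>M\<close> is the range of the spectral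
  projection of \<open>T|V\<close> for \<open>Z\<close>. For essentially positive Fredholm operators and the negative half-line
  this is the case, since the spectrum below some positive number is then finite.
\<close>

definition is_spectral_subspace ::
    "'a::complex_inner set \<Rightarrow> ('a \<Rightarrow> 'a) \<Rightarrow> complex set \<Rightarrow> 'a set \<Rightarrow> bool" where
  "is_spectral_subspace V T Z M \<longleftrightarrow>
     complex_vector.subspace M \<and> closed M \<and> M \<subseteq> V
     \<and> T ` M \<subseteq> M \<and> T ` orth_in V M \<subseteq> orth_in V M
     \<and> op_spectrum M T = op_spectrum V T \<inter> Z
     \<and> op_spectrum (orth_in V M) T = op_spectrum V T - Z"

definition spectral_subspace ::
    "'a::complex_inner set \<Rightarrow> ('a \<Rightarrow> 'a) \<Rightarrow> complex set \<Rightarrow> 'a set" where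
  "spectral_subspace V T Z = (THE M. is_spectral_subspace V T Z M)"

definition morse_index :: "'a::complex_inner set \<Rightarrow> ('a \<Rightarrow> 'a) \<Rightarrow> nat" where
  "morse_index V T = complex_vector.dim (spectral_subspace V T (complex_of_real ` {..<0}))"

definition dihedral_rep :: "nat \<Rightarrow> ('a::complex_inner \<Rightarrow> 'a) \<Rightarrow> ('a \<Rightarrow> 'a) \<Rightarrow> bool" where
  "dihedral_rep n R S \<longleftrightarrow>
     unitary R \<and> unitary S \<and> R ^^ n = id \<and> S ^^ 2 = id \<and> (S \<circ> R) ^^ 2 = id"

definition zeta :: "nat \<Rightarrow> complex" where
  "zeta n = exp (2 * complex_of_real pi * \<i> / of_nat n)"

definition E_rot :: "nat \<Rightarrow> ('a::complex_inner \<Rightarrow> 'a) \<Rightarrow> int \<Rightarrow> 'a set" where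
  "E_rot n R k = {x. R x = (zeta n powi k) *\<^sub>C x}"

text \<open>Only the values for \<open>0 \<le> k \<le> n div 2\<close> are meaningful.\<close>

definition F_iso :: "nat \<Rightarrow> ('a::complex_inner \<Rightarrow> 'a) \<Rightarrow> nat \<Rightarrow> 'a set" where
  "F_iso n R k =
     (if 1 \<le> k \<and> k \<le> (n - 1) div 2
      then {x + y | x y. x \<in> E_rot n R (int k) \<and> y \<in> E_rot n R (- int k)}
      else E_rot n R (int k))"

text \<open>The sign \<open>\<plusminus>\<close> is passed as \<open>s = 1\<close> or \<open>s = -1\<close>.\<close>

definition E_refl ::
    "('a::complex_inner \<Rightarrow> 'a) \<Rightarrow> ('a \<Rightarrow> 'a) \<Rightarrow> nat \<Rightarrow> real \<Rightarrow> 'a set" where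
  "E_refl R S h s = {x. S ((R ^^ h) x) = s *\<^sub>R x}"

definition F_refl ::
    "nat \<Rightarrow> ('a::complex_inner \<Rightarrow> 'a) \<Rightarrow> ('a \<Rightarrow> 'a) \<Rightarrow> nat \<Rightarrow> nat \<Rightarrow> real \<Rightarrow> 'a set" where
  "F_refl n R S k h s = {u \<in> F_iso n R k. S ((R ^^ h) u) = s *\<^sub>R u}"

end

theory Submission
  imports Defs
begin

text \<open>
  Both formulas are instances of one fact: the Morse index of \<open>A\<close> is additive over a finite orthogonal
  decomposition into \<open>A\<close>-invariant subspaces (\<open>morse_index_orthogonal_decomposition\<close>). The space
  decomposes into the eigenspaces of the involution \<open>S \<circ> R ^^ h\<close>, because its square is the identity.
  The isotypic components \<open>F_iso n R k\<close> decompose it as well, and since the reflection conjugates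
  \<open>R\<close> to its inverse, it preserves each of them; so the components of an eigenvector of the reflection
  are again eigenvectors, and \<open>F_refl\<close> decomposes \<open>E_refl\<close>. Equivariance makes all these subspaces
  invariant under \<open>A\<close>.

  Additivity is clear once the Morse index on a closed invariant subspace \<open>V\<close> is a count. Call a finite
  orthogonal set \<open>B\<close> of eigenvectors in \<open>V\<close> with negative eigenvalues a negative eigenbasis if the
  quadratic form of \<open>A\<close> is nonnegative on the orthogonal complement of \<open>B\<close> in \<open>V\<close>. Unions of negative
  eigenbases of the summands are negative eigenbases of the sum, and \<open>morse_index_eq_card\<close> says that
  the Morse index is the cardinality of any such set.

  A negative eigenbasis exists for the following reason. If the form is negative somewhere on a closed
  invariant subspace, the infimum of the numerical range there is a negative approximate eigenvalue
  (\<open>numerical_infimum_not_bounded_below\<close>). It lies outside the essential spectrum, so it is an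
  eigenvalue with an eigenvector in that subspace: a selfadjoint operator with closed range is bounded below on
  the complement of its kernel (\<open>closed_range_bounded_below\<close>, by uniform boundedness). The same bound
  isolates each nonpositive number from the other eigenvalues, so there are finitely many negative
  eigenvalues, each of finite multiplicity, and an orthogonal system of maximal size is a
  negative eigenbasis.

  That the span of a negative eigenbasis is the spectral subspace, and the only one, rests on the
  description of the spectrum by approximate eigenvalues (\<open>op_spectrum_iff\<close>): the sign of the
  spectrum on an invariant subspace decides the sign of the form there, and conversely.
\<close>

section \<open>Geometry of complex Hilbert spaces\<close>

lemma cinner_add_right: "cinner x (y + z) = cinner x y + cinner x (z::'a::complex_inner)"
  by (metis cinner_add_left cinner_commute complex_cnj_add)

lemma cinner_scaleC_right: "cinner x (c *\<^sub>C y) = cnj c * cinner x (y::'a::complex_inner)"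
  by (metis cinner_scaleC_left cinner_commute complex_cnj_mult)

lemma cinner_scaleR_left: "cinner (r *\<^sub>R x) (y::'a::complex_inner) = of_real r * cinner x y"
  by (simp add: scaleR_scaleC cinner_scaleC_left)

lemma cinner_scaleR_right: "cinner x (r *\<^sub>R (y::'a::complex_inner)) = of_real r * cinner x y"
  by (simp add: scaleR_scaleC cinner_scaleC_right)

lemma cinner_minus_left: "cinner (- x) (y::'a::complex_inner) = - cinner x y"
  using cinner_scaleR_left[of "-1" x y] by simp

lemma cinner_minus_right: "cinner x (- (y::'a::complex_inner)) = - cinner x y"
  using cinner_scaleR_right[of x "-1" y] by simp

lemma cinner_diff_left: "cinner (x - y) (z::'a::complex_inner) = cinner x z - cinner y z"
  using cinner_add_left[of x "- y" z] by (simp add: cinner_minus_left)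

lemma cinner_diff_right: "cinner x (y - (z::'a::complex_inner)) = cinner x y - cinner x z"
  using cinner_add_right[of x y "- z"] by (simp add: cinner_minus_right)

lemma cinner_zero_left [simp]: "cinner 0 (y::'a::complex_inner) = 0"
  using cinner_scaleR_left[of 0 0 y] by simp

lemma cinner_zero_right [simp]: "cinner (y::'a::complex_inner) 0 = 0"
  using cinner_scaleR_right[of y 0 0] by simp

lemma cinner_sum_left: "cinner (\<Sum>i\<in>I. f i) (y::'a::complex_inner) = (\<Sum>i\<in>I. cinner (f i) y)"
  by (induction I rule: infinite_finite_induct) (auto simp: cinner_add_left)

lemma cinner_sum_right: "cinner (y::'a::complex_inner) (\<Sum>i\<in>I. f i) = (\<Sum>i\<in>I. cinner y (f i))"
  by (induction I rule: infinite_finite_induct) (auto simp: cinner_add_right)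

lemmas cinner_simps = cinner_add_left cinner_add_right cinner_diff_left cinner_diff_right
  cinner_scaleC_left cinner_scaleC_right cinner_scaleR_left cinner_scaleR_right
  cinner_minus_left cinner_minus_right

lemma cinner_eq_zero_commute: "cinner x y = 0 \<longleftrightarrow> cinner y (x::'a::complex_inner) = 0"
  by (metis cinner_commute complex_cnj_zero)

lemma cinner_self_eq_zero [simp]: "cinner x x = 0 \<longleftrightarrow> (x::'a::complex_inner) = 0"
  by (simp add: cinner_self)

lemma Re_cinner_self: "Re (cinner x x) = (norm (x::'a::complex_inner))\<^sup>2"
  by (simp only: cinner_self Re_complex_of_real)

lemma Re_cinner_commute: "Re (cinner x y) = Re (cinner y (x::'a::complex_inner))"
  by (metis cinner_commute cnj.simps(1))

lemma norm_add_power2: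
  "(norm (x + y))\<^sup>2 = (norm x)\<^sup>2 + 2 * Re (cinner x y) + (norm (y::'a::complex_inner))\<^sup>2"
  using Re_cinner_self[of "x + y"] Re_cinner_commute[of y x]
  by (simp add: cinner_add_left cinner_add_right Re_cinner_self)

lemma norm_diff_power2:
  "(norm (x - y))\<^sup>2 = (norm x)\<^sup>2 - 2 * Re (cinner x y) + (norm (y::'a::complex_inner))\<^sup>2"
  using norm_add_power2[of x "- y"] by (simp add: cinner_minus_right)

lemma norm_scaleC: "norm (c *\<^sub>C x) = norm c * norm (x::'a::complex_inner)"
proof -
  have "cinner (c *\<^sub>C x) (c *\<^sub>C x) = of_real ((norm c)\<^sup>2) * cinner x x"
    by (simp add: cinner_scaleC_left cinner_scaleC_right complex_norm_square mult.assoc del: of_real_power)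
  then have "(norm (c *\<^sub>C x))\<^sup>2 = (norm c)\<^sup>2 * (norm x)\<^sup>2"
    using Re_cinner_self[of "c *\<^sub>C x"] by (simp add: Re_cinner_self del: of_real_power)
  then show ?thesis
    by (metis norm_ge_zero power2_eq_iff_nonneg power_mult_distrib mult_nonneg_nonneg)
qed

lemma cauchy_schwarz: "norm (cinner x y) \<le> norm x * norm (y::'a::complex_inner)"
proof (cases "y = 0")
  case False
  define c where "c = cinner x y / of_real ((norm y)\<^sup>2)"
  have y: "norm y \<noteq> 0" using False by simp
  \<comment> \<open>\<open>c *\<^sub>C y\<close> is the orthogonal projection of \<open>x\<close> to the line through \<open>y\<close>.\<close>
  have "cinner (x - c *\<^sub>C y) y = 0"
    using y by (simp add: cinner_simps c_def cinner_self)
  then have "cinner (x - c *\<^sub>C y) (c *\<^sub>C y) = 0"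
    by (simp add: cinner_scaleC_right)
  then have "(norm x)\<^sup>2 = (norm (x - c *\<^sub>C y))\<^sup>2 + (norm (c *\<^sub>C y))\<^sup>2"
    using norm_add_power2[of "x - c *\<^sub>C y" "c *\<^sub>C y"] by simp
  then have "norm (c *\<^sub>C y) \<le> norm x"
    by (metis le_add_same_cancel2 norm_ge_zero power2_le_imp_le zero_le_power2)
  moreover have "norm (c *\<^sub>C y) = norm (cinner x y) / norm y"
    using y by (simp add: norm_scaleC c_def norm_divide norm_power power2_eq_square norm_mult)
  ultimately show ?thesis
    using y by (simp add: divide_simps split: if_splits)
qed simp

lemma bounded_linear_cinner_left: "bounded_linear (\<lambda>x::'a::complex_inner. cinner x y)"
  by (rule bounded_linear_intro[where K = "norm y"])
    (use cauchy_schwarz in \<open>auto simp: cinner_simps scaleR_conv_of_real\<close>)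

lemma bounded_linear_scaleC_left: "bounded_linear (\<lambda>c. c *\<^sub>C (x::'a::complex_inner))"
  by (rule bounded_linear_intro[where K = "norm x"])
    (auto simp: scaleC_add_left norm_scaleC scaleR_scaleC scaleC_scaleC scaleR_conv_of_real)

lemma bounded_linear_scaleC_right: "bounded_linear (\<lambda>x::'a::complex_inner. c *\<^sub>C x)"
  by (rule bounded_linear_intro[where K = "norm c"])
    (auto simp: scaleC_add_right norm_scaleC scaleR_scaleC scaleC_scaleC mult_ac)

lemma csubspace_scaleR:
  "complex_vector.subspace V \<Longrightarrow> x \<in> V \<Longrightarrow> r *\<^sub>R (x::'a::complex_inner) \<in> V"
  by (simp add: scaleR_scaleC complex_vector.subspace_scale)

lemma csubspace_imp_subspace:
  "complex_vector.subspace (V::'a::complex_inner set) \<Longrightarrow> subspace V"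
  by (simp add: subspace_def complex_vector.subspace_0 complex_vector.subspace_add csubspace_scaleR)

lemma csubspace_orth_in:
  "complex_vector.subspace V \<Longrightarrow> complex_vector.subspace (orth_in V (M::'a::complex_inner set))"
  by (auto simp: complex_vector.subspace_def orth_in_def cinner_simps)

lemma closed_orth_in:
  assumes "closed V" shows "closed (orth_in V (M::'a::complex_inner set))"
proof -
  have "closed {x. cinner x y = 0}" for y :: 'a
    by (intro closed_Collect_eq bounded_linear.continuous_on[OF bounded_linear_cinner_left]
        continuous_intros)
  moreover have "orth_in V M = V \<inter> (\<Inter>y\<in>M. {x. cinner x y = 0})"
    by (auto simp: orth_in_def)
  ultimately show ?thesis using assms by auto
qed

text \<open>
  A minimizing sequence for the distance of \<open>x\<close> to \<open>V\<close> is Cauchy by the parallelogram law, and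
  its limit is the foot of the perpendicular because no step inside \<open>V\<close> can decrease the distance.
\<close>

lemma orthogonal_projection_exists:
  fixes V :: "'a::chilbert_space set"
  assumes V: "complex_vector.subspace V" "closed V"
  obtains p where "p \<in> V" "\<forall>y\<in>V. cinner (x - p) y = 0"
proof -
  define D where "D = (\<lambda>v. (norm (x - v))\<^sup>2) ` V"
  define d where "d = Inf D"
  have ne: "D \<noteq> {}" using complex_vector.subspace_0[OF V(1)] by (auto simp: D_def)
  have bd: "bdd_below D" by (rule bdd_belowI[of _ 0]) (auto simp: D_def)
  have d: "d \<le> (norm (x - v))\<^sup>2" if "v \<in> V" for v
    unfolding d_def by (rule cInf_lower[OF _ bd]) (use that in \<open>auto simp: D_def\<close>)
  have "\<exists>v\<in>V. (norm (x - v))\<^sup>2 < d + 1 / real (Suc j)" for j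
  proof -
    have "Inf D < d + 1 / real (Suc j)" by (simp add: d_def)
    then show ?thesis using cInf_less_iff[OF ne bd] by (auto simp: D_def)
  qed
  then obtain v where v: "\<And>j. v j \<in> V" "\<And>j. (norm (x - v j))\<^sup>2 < d + 1 / real (Suc j)"
    by metis
  have par: "(norm (v i - v j))\<^sup>2 \<le> 2 / real (Suc i) + 2 / real (Suc j)" for i j
  proof -
    define m where "m = (1/2) *\<^sub>R (v i + v j)"
    have "m \<in> V" unfolding m_def
      by (intro csubspace_scaleR complex_vector.subspace_add V v)
    have "(norm ((x - v i) + (x - v j)))\<^sup>2 = 4 * (norm (x - m))\<^sup>2"
    proof -
      have "(x - v i) + (x - v j) = 2 *\<^sub>R (x - m)"
        by (simp add: m_def algebra_simps scaleR_2)
      then show ?thesis by (simp add: power_mult_distrib)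
    qed
    moreover have "(norm ((x - v i) - (x - v j)))\<^sup>2 = (norm (v i - v j))\<^sup>2"
      by (simp add: norm_minus_commute)
    ultimately have "(norm (v i - v j))\<^sup>2 =
        2 * (norm (x - v i))\<^sup>2 + 2 * (norm (x - v j))\<^sup>2 - 4 * (norm (x - m))\<^sup>2"
      using norm_add_power2[of "x - v i" "x - v j"] norm_diff_power2[of "x - v i" "x - v j"]
      by linarith
    then show ?thesis
      using d[OF \<open>m \<in> V\<close>] v(2)[of i] v(2)[of j] by simp
  qed
  have "Cauchy v"
  proof (rule metric_CauchyI)
    fix e :: real assume "e > 0"
    obtain N where N: "4 / e\<^sup>2 < real N" using reals_Archimedean2 by blast
    have "dist (v i) (v j) < e" if "i \<ge> N" "j \<ge> N" for i j
    proof -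
      have "2 / real (Suc k) < e\<^sup>2 / 2" if "k \<ge> N" for k
      proof -
        have "4 / e\<^sup>2 < real (Suc k)" using N that by linarith
        then show ?thesis using \<open>e > 0\<close> by (simp add: field_simps)
      qed
      from this[OF that(1)] this[OF that(2)] par[of i j]
      have "(norm (v i - v j))\<^sup>2 < e\<^sup>2" by linarith
      then show ?thesis using \<open>e > 0\<close> by (simp add: dist_norm power2_less_imp_less)
    qed
    then show "\<exists>M. \<forall>m\<ge>M. \<forall>n\<ge>M. dist (v m) (v n) < e" by blast
  qed
  then obtain p where p: "v \<longlonglongrightarrow> p" using Cauchy_convergent_iff convergent_def by blast
  have "p \<in> V" using closed_sequentially[OF V(2) v(1) p] .
  have "(\<lambda>j. d + 1 / real (Suc j)) \<longlonglongrightarrow> d + 0"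
    by (intro tendsto_intros LIMSEQ_Suc[OF lim_1_over_n])
  moreover have "(\<lambda>j. (norm (x - v j))\<^sup>2) \<longlonglongrightarrow> (norm (x - p))\<^sup>2"
    by (intro tendsto_intros p)
  ultimately have pd: "(norm (x - p))\<^sup>2 \<le> d"
    using v(2) by (intro LIMSEQ_le) (auto intro: less_imp_le)
  have "cinner (x - p) y = 0" if "y \<in> V" for y
  proof -
    define c where "c = cinner (x - p) y"
    \<comment> \<open>Moving from \<open>p\<close> by \<open>t * c *\<^sub>C y\<close> changes the squared distance by \<open>- 2 * t * a + t\<^sup>2 * a * b\<close>,
      which is negative for small \<open>t\<close> unless \<open>a = 0\<close>.\<close>
    define a where "a = (norm c)\<^sup>2"
    define b where "b = (norm y)\<^sup>2"
    have key: "0 \<le> - 2 * t * a + t\<^sup>2 * (a * b)" for t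
    proof -
      have "p + (of_real t * c) *\<^sub>C y \<in> V"
        by (intro complex_vector.subspace_add complex_vector.subspace_scale V that \<open>p \<in> V\<close>)
      from d[OF this] pd have "(norm (x - p))\<^sup>2 \<le> (norm ((x - p) - (of_real t * c) *\<^sub>C y))\<^sup>2"
        unfolding diff_diff_eq by linarith
      also have "\<dots> = (norm (x - p))\<^sup>2 - 2 * t * a + t\<^sup>2 * (a * b)"
      proof -
        have "cinner (x - p) ((of_real t * c) *\<^sub>C y) = of_real t * (c * cnj c)"
          by (simp add:  cinner_scaleC_right c_def)
        then have "Re (cinner (x - p) ((of_real t * c) *\<^sub>C y)) = t * a"
          by (simp add: a_def complex_norm_square[symmetric] del: complex_mult_cnj)
        then show ?thesis
          by (subst norm_diff_power2) (simp add: norm_scaleC norm_mult power_mult_distrib a_def b_def)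
      qed
      finally show ?thesis by simp
    qed
    have "a = 0"
    proof (rule ccontr)
      assume "a \<noteq> 0"
      then have "a > 0" by (simp add: a_def)
      have "b \<ge> 0" by (simp add: b_def)
      define t where "t = 1 / (1 + b)"
      have t: "t > 0" "t * b \<le> 1" using \<open>b \<ge> 0\<close> by (auto simp: t_def)
      then have "(t * a) * (t * b - 2) < 0" using \<open>a > 0\<close> by (intro mult_pos_neg) auto
      then show False using key[of t] by (simp add: power2_eq_square algebra_simps)
    qed
    then show ?thesis by (simp add: a_def c_def)
  qed
  with \<open>p \<in> V\<close> that show thesis by blast
qed

text \<open>
  Uniform boundedness for the functionals \<open>\<lambda>x. cinner x g\<close>: if the vectors \<open>g\<close> bound each point
  separately, then by Baire one level set contains a ball, and a ball detects norms.
\<close>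

lemma weakly_bounded_imp_bounded:
  fixes G :: "'a::chilbert_space set"
  assumes weak: "\<And>x. \<exists>c. \<forall>g\<in>G. norm (cinner x g) \<le> c"
  shows "\<exists>C>0. \<forall>g\<in>G. norm g \<le> C"
proof -
  define L where "L N = {x. \<forall>g\<in>G. norm (cinner x g) \<le> real N}" for N
  have cl: "closed (L N)" for N
  proof -
    have "closed {x. norm (cinner x g) \<le> real N}" for g :: 'a
      by (intro closed_Collect_le bounded_linear.continuous_on[OF bounded_linear_cinner_left]
          continuous_intros)
    moreover have "L N = (\<Inter>g\<in>G. {x. norm (cinner x g) \<le> real N})" by (auto simp: L_def)
    ultimately show ?thesis by auto
  qed
  have cover: "(\<Union>N. L N) = UNIV"
  proof -
    have "\<exists>N. x \<in> L N" for x
    proof -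
      obtain c where c: "\<forall>g\<in>G. norm (cinner x g) \<le> c" using weak by blast
      obtain N where "c \<le> real N" using real_arch_simple by blast
      with c have "x \<in> L N" unfolding L_def by force
      then show ?thesis by blast
    qed
    then show ?thesis by auto
  qed
  have "\<exists>N. interior (L N) \<noteq> {}"
  proof (rule ccontr)
    assume "\<not> ?thesis"
    moreover have "completely_metrizable_space (euclidean :: 'a topology)"
      by (rule completely_metrizable_space_euclidean)
    ultimately have "(euclidean :: 'a topology) interior_of \<Union>(range L) = {}"
      by (intro Baire_category_alt) (auto simp: cl)
    then show False by (simp add: cover)
  qed
  then obtain N x e where e: "e > 0" "ball x e \<subseteq> L N"
    by (metis ex_in_conv mem_interior)
  have "norm g \<le> 4 * real N / e" if "g \<in> G" for g
  proof (cases "g = 0")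
    case False
    \<comment> \<open>Test \<open>g\<close> against the vector of length \<open>e / 2\<close> in its own direction.\<close>
    define u where "u = (e / (2 * norm g)) *\<^sub>R g"
    have "norm u < e" using e False by (simp add: u_def)
    then have "x + u \<in> L N" "x \<in> L N" using e by (auto simp: subset_iff dist_norm)
    then have "norm (cinner (x + u) g) \<le> real N" "norm (cinner x g) \<le> real N"
      using that by (auto simp: L_def)
    then have "norm (cinner u g) \<le> 2 * real N"
      using norm_triangle_ineq4[of "cinner (x + u) g" "cinner x g"] by (simp add: cinner_add_left)
    moreover have "norm (cinner u g) = e / 2 * norm g"
      using e False by (simp add: u_def cinner_scaleR_left cinner_self norm_mult norm_power norm_divide power2_eq_square)
    ultimately show ?thesis using e by (simp add: field_simps)
  qed (use e in simp)
  moreover have "4 * real N / e < 4 * real N / e + 1" "0 < 4 * real N / e + 1" 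
    using e by (auto intro: add_nonneg_pos)
  ultimately show ?thesis by (meson less_imp_le order_trans)
qed

section \<open>Orthogonal systems\<close>

lemma orthogonal_sum_eq_0:
  fixes f :: "'i \<Rightarrow> 'a::complex_inner"
  assumes "finite I" "pairwise (\<lambda>i j. cinner (f i) (f j) = 0) I" "(\<Sum>i\<in>I. f i) = 0" "i \<in> I"
  shows "f i = 0"
proof -
  have "0 = cinner (\<Sum>j\<in>I. f j) (f i)" using assms by simp
  also have "\<dots> = (\<Sum>j\<in>I. if j = i then cinner (f i) (f i) else 0)"
    unfolding cinner_sum_left by (rule sum.cong) (use assms in \<open>auto simp: pairwise_def\<close>)
  also have "\<dots> = cinner (f i) (f i)" using assms by simp
  finally show ?thesis by simp
qed

lemma norm_orthogonal_sum_power2: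
  fixes f :: "'i \<Rightarrow> 'a::complex_inner"
  assumes "finite I" "pairwise (\<lambda>i j. cinner (f i) (f j) = 0) I"
  shows "(norm (\<Sum>i\<in>I. f i))\<^sup>2 = (\<Sum>i\<in>I. (norm (f i))\<^sup>2)"
  using assms
proof (induction I rule: finite_induct)
  case (insert i I)
  have "cinner (f i) (\<Sum>j\<in>I. f j) = (\<Sum>j\<in>I. 0)"
    unfolding cinner_sum_right by (rule sum.cong) (use insert in \<open>auto simp: pairwise_insert\<close>)
  with insert show ?case by (simp add: norm_add_power2 pairwise_insert)
qed simp

definition orthogonal_system :: "'a::complex_inner set \<Rightarrow> bool" where
  "orthogonal_system B \<longleftrightarrow> 0 \<notin> B \<and> pairwise (\<lambda>b c. cinner b c = 0) B"

lemma orthogonal_system_independent: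
  assumes "orthogonal_system B"
  shows "complex_vector.independent B"
  unfolding complex_vector.independent_explicit_finite_subsets
proof (intro allI impI ballI)
  fix S u b assume S: "S \<subseteq> B" "finite S" and 0: "(\<Sum>v\<in>S. u v *\<^sub>C v) = 0" and b: "b \<in> S"
  have "pairwise (\<lambda>v w. cinner (u v *\<^sub>C v) (u w *\<^sub>C w) = 0) S"
    using assms S by (auto simp: orthogonal_system_def pairwise_def cinner_simps subset_iff)
  from orthogonal_sum_eq_0[OF S(2) this 0 b] have "u b *\<^sub>C b = 0" .
  moreover have "b \<noteq> 0" using assms S b by (auto simp: orthogonal_system_def)
  ultimately show "u b = 0" by simp
qed

lemma cinner_span_eq_0:
  assumes "\<forall>b\<in>B. cinner x b = 0" "y \<in> complex_vector.span B"
  shows "cinner x (y::'a::complex_inner) = 0"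
  using assms(2)
  by (induction rule: complex_vector.span_induct)
    (use assms(1) in \<open>auto simp: complex_vector.subspace_def cinner_simps\<close>)

lemma orth_in_span: "orth_in V (complex_vector.span B) = orth_in V B"
proof
  show "orth_in V (complex_vector.span B) \<subseteq> orth_in V B"
    by (auto simp: orth_in_def complex_vector.span_base)
  show "orth_in V B \<subseteq> orth_in V (complex_vector.span B)"
    by (auto simp: orth_in_def intro: cinner_span_eq_0)
qed

text \<open>The span is the set of fixed points of a continuous map, the Fourier expansion along \<open>B\<close>.\<close>

lemma closed_span_orthogonal_system:
  fixes B :: "'a::complex_inner set"
  assumes "finite B" "orthogonal_system B"
  shows "closed (complex_vector.span B)"
proof -
  define P where "P x = (\<Sum>b\<in>B. (cinner x b / cinner b b) *\<^sub>C b)" for x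
  have in_span: "P x \<in> complex_vector.span B" for x
    unfolding P_def
    by (intro complex_vector.span_sum complex_vector.span_scale complex_vector.span_base)
  have fixed: "P x = x" if "x \<in> complex_vector.span B" for x
  proof -
    have "cinner (x - P x) c = 0" if "c \<in> B" for c
    proof -
      have "cinner (P x) c = (\<Sum>b\<in>B. if b = c then cinner x c else 0)"
        unfolding P_def cinner_sum_left
        by (rule sum.cong) (use assms that in \<open>auto simp: orthogonal_system_def pairwise_def cinner_simps\<close>)
      then show ?thesis using assms that by (simp add: cinner_simps)
    qed
    then have "cinner (x - P x) (x - P x) = 0"
      by (intro cinner_span_eq_0[of B] complex_vector.span_diff that in_span) auto
    then show ?thesis by simp
  qed
  have "x \<in> complex_vector.span B" if "P x = x" for x
    using in_span[of x] that by simp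
  with fixed have "complex_vector.span B = {x. P x = x}" by blast
  moreover have "continuous_on UNIV P"
    unfolding P_def divide_inverse
    by (intro continuous_on_sum
        bounded_linear.continuous_on[OF bounded_linear_scaleC_left] continuous_on_mult
        bounded_linear.continuous_on[OF bounded_linear_cinner_left] continuous_on_id continuous_on_const)
  then have "closed {x. P x = x}"
    by (intro closed_Collect_eq) (auto intro: continuous_intros)
  ultimately show ?thesis by simp
qed

section \<open>The spectrum of a selfadjoint operator on an invariant subspace\<close>

lemma csubspace_image:
  assumes T: "bounded_clinear T" and V: "complex_vector.subspace V"
  shows "complex_vector.subspace (T ` V)"
proof -
  interpret bounded_linear T using T by (simp add: bounded_clinear_def)
  have C: "T (c *\<^sub>C x) = c *\<^sub>C T x" for c x using T by (simp add: bounded_clinear_def)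
  show ?thesis
    unfolding complex_vector.subspace_def
  proof (intro conjI ballI allI)
    show "0 \<in> T ` V" using complex_vector.subspace_0[OF V] zero by (metis image_eqI)
    fix x assume "x \<in> T ` V"
    then obtain v where v: "x = T v" "v \<in> V" by blast
    show "c *\<^sub>C x \<in> T ` V" for c
      using complex_vector.subspace_scale[OF V v(2)] C v(1) by (metis image_eqI)
    fix y assume "y \<in> T ` V"
    then obtain w where w: "y = T w" "w \<in> V" by blast
    show "x + y \<in> T ` V"
      using complex_vector.subspace_add[OF V v(2) w(2)] add v(1) w(1) by (metis image_eqI)
  qed
qed

lemma selfadjointD:
  assumes "selfadjoint A"
  shows "bounded_linear A" "A (c *\<^sub>C x) = c *\<^sub>C A x" "cinner (A x) y = cinner x (A y)"
    "A (x + y) = A x + A y" "A (x - y) = A x - A y" "A 0 = 0" "A (r *\<^sub>R x) = r *\<^sub>R A x"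
    "A (sum f I) = (\<Sum>i\<in>I. A (f i))"
proof -
  show bl: "bounded_linear A" and "A (c *\<^sub>C x) = c *\<^sub>C A x" and "cinner (A x) y = cinner x (A y)"
    using assms unfolding selfadjoint_def bounded_clinear_def by blast+
  interpret bounded_linear A by (rule bl)
  show "A (x + y) = A x + A y" "A (x - y) = A x - A y" "A 0 = 0" "A (r *\<^sub>R x) = r *\<^sub>R A x"
    "A (sum f I) = (\<Sum>i\<in>I. A (f i))"
    by (rule add diff zero scaleR sum)+
qed

lemma selfadjoint_cinner_self: "selfadjoint A \<Longrightarrow> cinner (A x) x = of_real (Re (cinner (A x) x))"
  by (metis Reals_cnj_iff cinner_commute complex_is_Real_iff of_real_Re selfadjointD(3))

lemma bounded_linear_shift:
  "bounded_linear A \<Longrightarrow> bounded_linear (\<lambda>x. A x - z *\<^sub>C (x::'a::complex_inner))"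
  by (intro bounded_linear_sub bounded_linear_scaleC_right)

lemma bounded_clinear_shift:
  "bounded_clinear A \<Longrightarrow> bounded_clinear (\<lambda>x. A x - z *\<^sub>C x)"
  by (simp add: bounded_clinear_def bounded_linear_shift complex_vector.scale_right_diff_distrib
      scaleC_scaleC mult.commute)

lemma selfadjoint_real_shift:
  assumes "selfadjoint A" shows "selfadjoint (\<lambda>x. A x - complex_of_real m *\<^sub>C x)"
  unfolding selfadjoint_def
  using assms bounded_clinear_shift[of A] selfadjointD(3)[OF assms]
  by (auto simp: cinner_simps selfadjoint_def)

definition closed_invariant :: "('a::complex_inner \<Rightarrow> 'a) \<Rightarrow> 'a set \<Rightarrow> bool" where
  "closed_invariant A V \<longleftrightarrow> complex_vector.subspace V \<and> closed V \<and> A ` V \<subseteq> V"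

lemma closed_invariantD:
  assumes "closed_invariant A V"
  shows "complex_vector.subspace V" "closed V" "x \<in> V \<Longrightarrow> A x \<in> V"
  using assms by (auto simp: closed_invariant_def)

lemma closed_invariant_shift_mem:
  "closed_invariant A V \<Longrightarrow> x \<in> V \<Longrightarrow> A x - z *\<^sub>C x \<in> V"
  by (simp add: closed_invariantD complex_vector.subspace_diff complex_vector.subspace_scale)

lemma closed_invariant_orth_in:
  assumes "selfadjoint A" "closed_invariant A V" "\<And>b. b \<in> M \<Longrightarrow> A b \<in> complex_vector.span M"
  shows "closed_invariant A (orth_in V M)"
  unfolding closed_invariant_def
proof (intro conjI subsetI)
  fix y assume "y \<in> A ` orth_in V M"
  then obtain x where x: "y = A x" "x \<in> V" "\<forall>b\<in>M. cinner x b = 0" by (auto simp: orth_in_def)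
  then show "y \<in> orth_in V M"
    using cinner_span_eq_0[OF x(3)] assms closed_invariantD(3)[OF assms(2)]
    by (auto simp: orth_in_def selfadjointD(3)[OF assms(1)])
qed (use assms in \<open>auto simp: closed_invariant_def intro: csubspace_orth_in closed_orth_in\<close>)

lemma closed_invariant_split:
  fixes V :: "'a::chilbert_space set"
  assumes "closed_invariant A V" "closed_invariant A M" "M \<subseteq> V" "x \<in> V"
  obtains a b where "a \<in> M" "b \<in> orth_in V M" "x = a + b"
proof -
  obtain p where p: "p \<in> M" "\<forall>y\<in>M. cinner (x - p) y = 0"
    using orthogonal_projection_exists closed_invariantD(1,2)[OF assms(2)] by metis
  then have "x - p \<in> orth_in V M"
    using assms closed_invariantD(1)[OF assms(1)]
    by (auto simp: orth_in_def intro!: complex_vector.subspace_diff)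
  with p that[of p "x - p"] show ?thesis by simp
qed

definition bounded_below_on :: "'a::real_normed_vector set \<Rightarrow> ('a \<Rightarrow> 'a) \<Rightarrow> bool" where
  "bounded_below_on V T \<longleftrightarrow> (\<exists>c>0. \<forall>x\<in>V. c * norm x \<le> norm (T x))"

lemma bounded_below_on_subset: "bounded_below_on V T \<Longrightarrow> W \<subseteq> V \<Longrightarrow> bounded_below_on W T"
  unfolding bounded_below_on_def by blast

text \<open>
  On an invariant subspace every spectral value is an approximate eigenvalue: the range of a
  shift that is bounded below is closed, and the conjugate shift, which is bounded below by the same
  constant, annihilates its orthogonal complement, which is therefore zero.
\<close>

lemma op_spectrum_iff:
  fixes A :: "'a::chilbert_space \<Rightarrow> 'a"
  assumes A: "selfadjoint A" and V: "closed_invariant A V"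
  shows "z \<in> op_spectrum V A \<longleftrightarrow> \<not> bounded_below_on V (\<lambda>x. A x - z *\<^sub>C x)"
proof
  show "\<not> bounded_below_on V (\<lambda>x. A x - z *\<^sub>C x) \<Longrightarrow> z \<in> op_spectrum V A"
  proof (rule ccontr)
    assume nb: "\<not> bounded_below_on V (\<lambda>x. A x - z *\<^sub>C x)" and "z \<notin> op_spectrum V A"
    then obtain C where C: "\<forall>x\<in>V. norm x \<le> C * norm (A x - z *\<^sub>C x)"
      by (auto simp: op_spectrum_def)
    have "1 / max C 1 * norm x \<le> norm (A x - z *\<^sub>C x)" if "x \<in> V" for x
    proof -
      have "norm x \<le> max C 1 * norm (A x - z *\<^sub>C x)"
        using C that by (meson max.cobounded1 mult_right_mono norm_ge_zero order_trans)
      then show ?thesis by (simp add: field_simps max_def)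
    qed
    moreover have "1 / max C 1 > 0" by simp
    ultimately show False using nb unfolding bounded_below_on_def by blast
  qed
next
  assume z: "z \<in> op_spectrum V A"
  show "\<not> bounded_below_on V (\<lambda>x. A x - z *\<^sub>C x)"
  proof
    assume "bounded_below_on V (\<lambda>x. A x - z *\<^sub>C x)"
    then obtain c where c: "c > 0" "\<forall>x\<in>V. c * norm x \<le> norm (A x - z *\<^sub>C x)"
      by (auto simp: bounded_below_on_def)
    define T where "T = (\<lambda>x. A x - z *\<^sub>C x)"
    note AD = selfadjointD[OF A] and VD = closed_invariantD[OF V]
    have T: "bounded_linear T" unfolding T_def by (rule bounded_linear_shift[OF AD(1)])
    have TV: "T x \<in> V" if "x \<in> V" for x
      using closed_invariant_shift_mem[OF V that] by (simp add: T_def)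
    have adj: "cinner q (T x) = cinner (A q - cnj z *\<^sub>C q) x" for q x
      by (simp add: T_def cinner_simps AD(3))
    have norm_eq: "norm (A q - cnj z *\<^sub>C q) = norm (T q)" for q
    proof -
      have "Re (cinner (A q) (cnj z *\<^sub>C q)) = Re (cinner (A q) (z *\<^sub>C q))"
        by (subst (1 2) cinner_scaleC_right, subst (1 2) selfadjoint_cinner_self[OF A]) simp
      then have "(norm (A q - cnj z *\<^sub>C q))\<^sup>2 = (norm (T q))\<^sup>2"
        by (simp add: T_def norm_diff_power2 norm_scaleC)
      then show ?thesis by simp
    qed
    have "inj_on T V"
    proof (rule inj_onI)
      fix x y assume "x \<in> V" "y \<in> V" "T x = T y"
      then have "x - y \<in> V" "T (x - y) = 0"
        using T VD(1) by (auto simp: complex_vector.subspace_diff linear_simps)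
      then have "norm (x - y) = 0"
        using c unfolding T_def by (metis mult_le_0_iff norm_le_zero_iff norm_zero not_le)
      then show "x = y" by simp
    qed
    moreover have "T ` V = V"
    proof
      have "complete (T ` V)"
        by (rule complete_isometric_image[OF c(1) csubspace_imp_subspace[OF VD(1)] T])
          (use c VD(2) in \<open>auto simp: T_def complete_eq_closed\<close>)
      then have cl: "closed (T ` V)" by (rule complete_imp_closed)
      have "bounded_clinear T"
        using A unfolding T_def by (intro bounded_clinear_shift) (simp add: selfadjoint_def)
      then have sub: "complex_vector.subspace (T ` V)" by (rule csubspace_image[OF _ VD(1)])
      show "T ` V \<subseteq> V" using TV by blast
      show "V \<subseteq> T ` V"
      proof
        fix y assume y: "y \<in> V"
        obtain p where p: "p \<in> T ` V" "\<forall>w\<in>T ` V. cinner (y - p) w = 0"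
          using orthogonal_projection_exists[OF sub cl] by metis
        define q where "q = y - p"
        have "p \<in> V" using p(1) TV by blast
        then have "q \<in> V" unfolding q_def by (intro complex_vector.subspace_diff VD(1) y)
        then have "A q - cnj z *\<^sub>C q \<in> V" by (rule closed_invariant_shift_mem[OF V])
        then have "cinner q (T (A q - cnj z *\<^sub>C q)) = 0" using p(2) by (auto simp: q_def)
        then have "A q - cnj z *\<^sub>C q = 0" unfolding adj by simp
        then have "T q = 0" using norm_eq[of q] by simp
        then have "norm q = 0"
          using c \<open>q \<in> V\<close> unfolding T_def by (metis mult_le_0_iff norm_le_zero_iff norm_zero not_le)
        then show "y \<in> T ` V" using p(1) by (simp add: q_def)
      qed
    qed
    ultimately have "bij_betw (\<lambda>x. A x - z *\<^sub>C x) V V" by (simp add: bij_betw_def T_def)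
    moreover have "\<forall>x\<in>V. norm x \<le> (1 / c) * norm (A x - z *\<^sub>C x)"
      using c by (simp add: field_simps)
    ultimately show False using z unfolding op_spectrum_def by blast
  qed
qed

text \<open>A splitting block-diagonalizes each shift, and Pythagoras compares the lower bounds.\<close>

lemma op_spectrum_split:
  fixes A :: "'a::chilbert_space \<Rightarrow> 'a"
  assumes A: "selfadjoint A" and V: "closed_invariant A V" and M: "closed_invariant A M" "M \<subseteq> V"
  shows "op_spectrum V A = op_spectrum M A \<union> op_spectrum (orth_in V M) A"
proof -
  have N: "closed_invariant A (orth_in V M)"
    by (rule closed_invariant_orth_in[OF A V]) (use M in \<open>auto intro: complex_vector.span_base closed_invariantD\<close>)
  have "bounded_below_on V T" if T: "T = (\<lambda>x. A x - z *\<^sub>C x)"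
    and bb: "bounded_below_on M T" "bounded_below_on (orth_in V M) T" for T z
  proof -
    obtain c d where c: "c > 0" "\<forall>x\<in>M. c * norm x \<le> norm (T x)"
      and d: "d > 0" "\<forall>x\<in>orth_in V M. d * norm x \<le> norm (T x)"
      using bb unfolding bounded_below_on_def by blast
    define e where "e = min c d"
    have "e * norm x \<le> norm (T x)" if x: "x \<in> V" for x
    proof -
      obtain a b where ab: "a \<in> M" "b \<in> orth_in V M" "x = a + b"
        using closed_invariant_split[OF V M x] .
      have T_mem: "T a \<in> M" "T b \<in> orth_in V M"
        using closed_invariant_shift_mem M(1) N ab T by blast+
      have orth: "cinner v w = 0" if "v \<in> M" "w \<in> orth_in V M" for v w
        using that by (auto simp: orth_in_def cinner_eq_zero_commute)
      have "T x = T a + T b"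
        unfolding T ab selfadjointD(4)[OF A] scaleC_add_right by (rule add_diff_add)
      then have "(norm (T x))\<^sup>2 = (norm (T a))\<^sup>2 + (norm (T b))\<^sup>2"
        using orth[OF T_mem] by (simp add: norm_add_power2)
      moreover have "(norm x)\<^sup>2 = (norm a)\<^sup>2 + (norm b)\<^sup>2"
        using orth[OF ab(1,2)] by (simp add: norm_add_power2 ab)
      moreover have "e * norm a \<le> norm (T a)" "e * norm b \<le> norm (T b)"
        using c(2) d(2) ab e_def
        by (meson min.cobounded1 min.cobounded2 mult_right_mono norm_ge_zero order_trans)+
      then have "(e * norm a)\<^sup>2 \<le> (norm (T a))\<^sup>2" "(e * norm b)\<^sup>2 \<le> (norm (T b))\<^sup>2"
        using c d by (auto intro!: power_mono simp: e_def)
      ultimately have "(e * norm x)\<^sup>2 \<le> (norm (T x))\<^sup>2"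
        by (simp add: power_mult_distrib distrib_left)
      then show ?thesis by (rule power2_le_imp_le) simp
    qed
    moreover have "e > 0" using c d by (simp add: e_def)
    ultimately show ?thesis unfolding bounded_below_on_def by blast
  qed
  moreover have "orth_in V M \<subseteq> V" by (auto simp: orth_in_def)
  ultimately show ?thesis
    using op_spectrum_iff[OF A V] op_spectrum_iff[OF A M(1)] op_spectrum_iff[OF A N] M(2)
      bounded_below_on_subset by blast
qed

text \<open>
  The infimum \<open>m\<close> of the numerical range is an approximate eigenvalue. The form of \<open>A - m\<close> is
  nonnegative at \<open>x - t *\<^sub>R (A - m) x\<close>, so it controls \<open>norm ((A - m) x)\<close>; if \<open>A - m\<close> were bounded
  below, its form would be bounded below by a positive multiple of \<open>(norm x)\<^sup>2\<close>, which contradicts the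
  choice of \<open>m\<close>.
\<close>

lemma numerical_infimum_not_bounded_below:
  fixes A :: "'a::complex_inner \<Rightarrow> 'a"
  assumes A: "selfadjoint A" and W: "complex_vector.subspace W" "A ` W \<subseteq> W" and y: "y \<in> W" "y \<noteq> 0"
  obtains m where "m * (norm y)\<^sup>2 \<le> Re (cinner (A y) y)"
    and "\<not> bounded_below_on W (\<lambda>x. A x - complex_of_real m *\<^sub>C x)"
proof -
  note AD = selfadjointD[OF A]
  define D where "D = (\<lambda>x. Re (cinner (A x) x)) ` {x \<in> W. norm x = 1}"
  define m where "m = Inf D"
  have "bdd_below D"
  proof -
    have "- onorm A \<le> Re (cinner (A x) x)" if "norm x = 1" for x
    proof -
      have "\<bar>Re (cinner (A x) x)\<bar> \<le> onorm A"
        using abs_Re_le_cmod[of "cinner (A x) x"] cauchy_schwarz[of "A x" x] onorm[OF AD(1), of x] that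
        by simp
      then show ?thesis by linarith
    qed
    then show ?thesis by (intro bdd_belowI[of _ "- onorm A"]) (auto simp: D_def)
  qed
  have normed: "Re (cinner (A x) x) / (norm x)\<^sup>2 \<in> D" if "x \<in> W" "x \<noteq> 0" for x
  proof -
    have "(1 / norm x) *\<^sub>R x \<in> {x \<in> W. norm x = 1}"
      using that W(1) by (auto intro: csubspace_scaleR)
    moreover have "Re (cinner (A ((1 / norm x) *\<^sub>R x)) ((1 / norm x) *\<^sub>R x)) = Re (cinner (A x) x) / (norm x)\<^sup>2"
      by (simp add: AD(7) cinner_scaleR_left cinner_scaleR_right power2_eq_square)
    ultimately show ?thesis unfolding D_def by (metis (mono_tags, lifting) image_eqI)
  qed
  then have "D \<noteq> {}" using y by blast
  have m: "m * (norm x)\<^sup>2 \<le> Re (cinner (A x) x)" if "x \<in> W" for x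
  proof (cases "x = 0")
    case False
    then have "m \<le> Re (cinner (A x) x) / (norm x)\<^sup>2"
      unfolding m_def using cInf_lower normed that \<open>bdd_below D\<close> by blast
    with False show ?thesis by (simp add: field_simps)
  qed simp
  define T where "T = (\<lambda>x. A x - complex_of_real m *\<^sub>C x)"
  have T: "selfadjoint T" unfolding T_def by (rule selfadjoint_real_shift[OF A])
  note TD = selfadjointD[OF T]
  have form: "Re (cinner (T x) x) = Re (cinner (A x) x) - m * (norm x)\<^sup>2" for x
    by (simp add: T_def cinner_simps Re_cinner_self)
  have TW: "T x \<in> W" if "x \<in> W" for x
    using that W unfolding T_def
    by (intro complex_vector.subspace_diff complex_vector.subspace_scale) auto
  have "\<not> bounded_below_on W T"
  proof
    assume "bounded_below_on W T"
    then obtain c where c: "c > 0" "\<forall>x\<in>W. c * norm x \<le> norm (T x)"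
      by (auto simp: bounded_below_on_def)
    obtain C where C: "C > 0" "\<And>x. norm (T x) \<le> norm x * C"
      using bounded_linear.pos_bounded[OF TD(1)] by blast
    have lower: "m + c\<^sup>2 / C \<le> Re (cinner (A x) x)" if x: "x \<in> W" "norm x = 1" for x
    proof -
      \<comment> \<open>This \<open>t\<close> minimizes the quadratic upper bound \<open>- 2 * t + t\<^sup>2 * C\<close> that appears below.\<close>
      define t where "t = 1 / C"
      have "x - t *\<^sub>R T x \<in> W"
        by (intro complex_vector.subspace_diff csubspace_scaleR W x TW)
      from m[OF this] have "0 \<le> Re (cinner (T (x - t *\<^sub>R T x)) (x - t *\<^sub>R T x))"
        by (simp add: form)
      also have "\<dots> = Re (cinner (T x) x) - 2 * t * (norm (T x))\<^sup>2 + t\<^sup>2 * Re (cinner (T (T x)) (T x))"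
      proof -
        have "cinner (T (T x)) x = cinner (T x) (T x)" by (rule TD(3))
        then show ?thesis
          by (simp add: TD(5,7) cinner_simps Re_cinner_self power2_eq_square algebra_simps)
      qed
      also have "\<dots> \<le> Re (cinner (T x) x) - 2 * t * (norm (T x))\<^sup>2 + t\<^sup>2 * (C * (norm (T x))\<^sup>2)"
      proof -
        have "Re (cinner (T (T x)) (T x)) \<le> norm (T (T x)) * norm (T x)"
          using complex_Re_le_cmod cauchy_schwarz order_trans by blast
        also have "\<dots> \<le> (norm (T x) * C) * norm (T x)"
          by (intro mult_right_mono C) simp
        finally have "Re (cinner (T (T x)) (T x)) \<le> C * (norm (T x))\<^sup>2"
          by (simp add: power2_eq_square mult_ac)
        then show ?thesis by (simp add: mult_left_mono)
      qed
      also have "\<dots> = Re (cinner (T x) x) - (norm (T x))\<^sup>2 / C"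
        using C(1) by (simp add: t_def power2_eq_square field_simps)
      finally have "(norm (T x))\<^sup>2 / C \<le> Re (cinner (A x) x) - m"
        using x by (simp add: form)
      moreover have "c\<^sup>2 / C \<le> (norm (T x))\<^sup>2 / C"
        using c x C by (intro divide_right_mono power_mono) auto
      ultimately show ?thesis by linarith
    qed
    have "m + c\<^sup>2 / C \<le> m"
      unfolding m_def[symmetric] by (subst (2) m_def, rule cInf_greatest[OF \<open>D \<noteq> {}\<close>]) (auto simp: D_def intro: lower)
    moreover have "c\<^sup>2 / C > 0" using c C by simp
    ultimately show False by linarith
  qed
  with m[OF y(1)] that show thesis unfolding T_def by blast
qed

section \<open>Nonpositive approximate eigenvalues of essentially positive operators\<close>

text \<open>
  For \<open>y\<close> in the closed range and any \<open>x = T u + q\<close> with \<open>q\<close> orthogonal to the range,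
  \<open>cinner x y = cinner u (T y)\<close>. So those \<open>y\<close> with \<open>norm (T y) = 1\<close> are weakly bounded, hence bounded,
  and the complement of the kernel is contained in the range.
\<close>

lemma closed_range_bounded_below:
  fixes T :: "'a::chilbert_space \<Rightarrow> 'a"
  assumes T: "selfadjoint T" and cl: "closed (range T)"
  shows "bounded_below_on (orth_in UNIV {x. T x = 0}) T"
proof -
  note TD = selfadjointD[OF T]
  have sub: "complex_vector.subspace (range T)"
    by (rule csubspace_image[OF _ complex_vector.subspace_UNIV]) (use T in \<open>simp add: selfadjoint_def\<close>)
  have "\<exists>p. p \<in> range T \<and> (\<forall>y\<in>range T. cinner (x - p) y = 0)" for x
    by (rule orthogonal_projection_exists[OF sub cl, of x]) blast
  then obtain P where P: "\<And>x. P x \<in> range T" "\<And>x y. y \<in> range T \<Longrightarrow> cinner (x - P x) y = 0"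
    by metis
  have ker: "T (x - P x) = 0" for x
  proof -
    have "cinner (T (x - P x)) (T (x - P x)) = cinner (x - P x) (T (T (x - P x)))"
      by (rule TD(3))
    also have "\<dots> = 0" by (rule P(2)) simp
    finally show ?thesis by simp
  qed
  have perp: "y \<in> range T" if y: "y \<in> orth_in UNIV {x. T x = 0}" for y
  proof -
    have "cinner y (y - P y) = 0" using y ker by (auto simp: orth_in_def)
    moreover have "cinner (P y) (y - P y) = 0"
      using P(2)[OF P(1)] cinner_eq_zero_commute by blast
    ultimately have "cinner (y - P y) (y - P y) = 0" by (simp add: cinner_diff_left)
    then have "y = P y" by simp
    then show ?thesis using P(1)[of y] by simp
  qed
  define G where "G = {y \<in> range T. norm (T y) = 1}"
  have "\<exists>c. \<forall>g\<in>G. norm (cinner x g) \<le> c" for x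
  proof -
    obtain u where u: "P x = T u" using P(1)[of x] by blast
    have "norm (cinner x g) \<le> norm u" if "g \<in> G" for g
    proof -
      have "cinner x g = cinner (P x) g"
        using P(2)[of g x] that by (auto simp: G_def cinner_diff_left)
      also have "\<dots> = cinner u (T g)" by (simp add: u TD(3))
      finally show ?thesis using cauchy_schwarz[of u "T g"] that by (simp add: G_def)
    qed
    then show ?thesis by blast
  qed
  then obtain C where C: "C > 0" "\<And>g. g \<in> G \<Longrightarrow> norm g \<le> C"
    using weakly_bounded_imp_bounded[of G] by metis
  have "1 / C * norm y \<le> norm (T y)" if y: "y \<in> orth_in UNIV {x. T x = 0}" for y
  proof (cases "T y = 0")
    case True
    then have "cinner y y = 0" using y by (auto simp: orth_in_def)
    then show ?thesis by simp
  next
    case False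
    have "(1 / norm (T y)) *\<^sub>R y \<in> G"
      using perp[OF y] csubspace_scaleR[OF sub] False by (simp add: G_def TD(7))
    from C(2)[OF this] show ?thesis using False C(1) by (simp add: field_simps)
  qed
  moreover have "1 / C > 0" using C by simp
  ultimately show ?thesis unfolding bounded_below_on_def by blast
qed

lemma essentially_positive_fredholm:
  assumes "essentially_positive A" "m \<le> 0"
  shows "fredholm (\<lambda>x. A x - complex_of_real m *\<^sub>C x)"
proof (rule ccontr)
  assume "\<not> ?thesis"
  then have "complex_of_real m \<in> complex_of_real ` {0<..}"
    using assms(1) by (auto simp: essentially_positive_def essential_spectrum_def)
  then show False using assms(2) by auto
qed

text \<open>
  The projection to \<open>W\<close> commutes with \<open>A\<close>, hence preserves the eigenspace for \<open>m\<close>. If \<open>W\<close> contains no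
  eigenvector, it is therefore orthogonal to the eigenspace, and \<open>A - m\<close> is bounded below on the
  orthogonal complement of its kernel.
\<close>

lemma approximate_eigenvalue_imp_eigenvector:
  fixes A :: "'a::chilbert_space \<Rightarrow> 'a"
  assumes A: "essentially_positive A" and "m \<le> 0" and W: "closed_invariant A W"
    and nb: "\<not> bounded_below_on W (\<lambda>x. A x - complex_of_real m *\<^sub>C x)"
  obtains e where "e \<in> W" "e \<noteq> 0" "A e = m *\<^sub>R e"
proof (rule ccontr)
  assume "\<not> thesis"
  with that have none: "x = 0" if "x \<in> W" "A x = m *\<^sub>R x" for x using that by blast
  have sa: "selfadjoint A" using A by (simp add: essentially_positive_def)
  note AD = selfadjointD[OF sa] and WD = closed_invariantD[OF W]
  define T where "T = (\<lambda>x. A x - complex_of_real m *\<^sub>C x)"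
  have T: "selfadjoint T" "closed (range T)"
    using selfadjoint_real_shift[OF sa] essentially_positive_fredholm[OF A \<open>m \<le> 0\<close>]
    by (auto simp: T_def fredholm_def)
  have "W \<subseteq> orth_in UNIV {x. T x = 0}"
  proof
    fix w assume w: "w \<in> W"
    have "cinner w x = 0" if x: "T x = 0" for x
    proof -
      obtain a b where ab: "a \<in> W" "b \<in> orth_in UNIV W" "x = a + b"
        by (rule closed_invariant_split[OF _ W, of UNIV x]) (auto simp: closed_invariant_def)
      have "closed_invariant A (orth_in UNIV W)"
        by (rule closed_invariant_orth_in[OF sa])
          (auto intro: WD complex_vector.span_base simp: closed_invariant_def)
      from closed_invariant_shift_mem[OF this ab(2)] have "cinner (T b) (T a) = 0"
        using closed_invariant_shift_mem[OF W ab(1)] by (auto simp: orth_in_def T_def)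
      moreover have "T b = - T a"
        using x unfolding ab(3) selfadjointD(4)[OF T(1)] by (simp add: eq_neg_iff_add_eq_0 add.commute)
      ultimately have "T a = 0" by (simp add: cinner_minus_left)
      then have "a = 0" using none[OF ab(1)] by (simp add: T_def scaleR_scaleC)
      then show ?thesis using ab w by (auto simp: orth_in_def cinner_eq_zero_commute[of w])
    qed
    then show "w \<in> orth_in UNIV {x. T x = 0}" by (simp add: orth_in_def)
  qed
  then show False
    using closed_range_bounded_below[OF T] nb bounded_below_on_subset unfolding T_def by blast
qed

section \<open>Negative eigenbases\<close>

lemma eigenvectors_orthogonal:
  assumes A: "selfadjoint A" and "A x = l *\<^sub>R x" "A y = m *\<^sub>R y" "l \<noteq> m"
  shows "cinner x y = 0"
proof -
  have "of_real l * cinner x y = of_real m * cinner x y"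
    using selfadjointD(3)[OF A, of x y] assms by (simp add: cinner_scaleR_left cinner_scaleR_right)
  then show ?thesis using assms(4) by simp
qed

definition eigenvalues :: "('a::complex_inner \<Rightarrow> 'a) \<Rightarrow> real set" where
  "eigenvalues A = {l. \<exists>x. x \<noteq> 0 \<and> A x = l *\<^sub>R x}"

text \<open>
  Eigenvectors for \<open>l \<noteq> z\<close> are orthogonal to the kernel of \<open>A - z\<close>, and on the complement of that
  kernel \<open>A - z\<close> is bounded below, so \<open>l\<close> keeps a distance from \<open>z\<close>. Hence a nonpositive
  \<open>z\<close> is no limit point of eigenvalues, and by compactness the negative ones, which lie in a bounded
  interval, are finite in number.
\<close>

lemma finite_negative_eigenvalues:
  fixes A :: "'a::chilbert_space \<Rightarrow> 'a"
  assumes A: "essentially_positive A"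
  shows "finite (eigenvalues A \<inter> {..<0})"
proof (rule ccontr)
  assume inf: "infinite (eigenvalues A \<inter> {..<0})"
  have sa: "selfadjoint A" using A by (simp add: essentially_positive_def)
  note AD = selfadjointD[OF sa]
  have "eigenvalues A \<inter> {..<0} \<subseteq> {- onorm A..0}"
  proof
    fix l assume "l \<in> eigenvalues A \<inter> {..<0}"
    then obtain x where "x \<noteq> 0" "A x = l *\<^sub>R x" "l < 0" by (auto simp: eigenvalues_def)
    then have "- l * norm x \<le> onorm A * norm x" using onorm[OF AD(1), of x] by simp
    then have "- l \<le> onorm A" by (rule mult_right_le_imp_le) (use \<open>x \<noteq> 0\<close> in simp)
    then show "l \<in> {- onorm A..0}" using \<open>l < 0\<close> by simp
  qed
  then obtain z where z: "z \<in> {- onorm A..0}" "z islimpt (eigenvalues A \<inter> {..<0})"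
    using Heine_Borel_imp_Bolzano_Weierstrass[OF compact_Icc inf] by blast
  define T where "T = (\<lambda>x. A x - complex_of_real z *\<^sub>C x)"
  have "selfadjoint T" "closed (range T)"
    using selfadjoint_real_shift[OF sa] essentially_positive_fredholm[OF A, of z] z
    by (auto simp: T_def fredholm_def)
  then obtain c where c: "c > 0" "\<And>x. x \<in> orth_in UNIV {x. T x = 0} \<Longrightarrow> c * norm x \<le> norm (T x)"
    using closed_range_bounded_below unfolding bounded_below_on_def by blast
  obtain l where l: "l \<in> eigenvalues A" "l \<noteq> z" "dist l z < c"
    using z(2) c(1) unfolding islimpt_approachable by blast
  then obtain x where x: "x \<noteq> 0" "A x = l *\<^sub>R x" by (auto simp: eigenvalues_def)
  have "x \<in> orth_in UNIV {x. T x = 0}"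
    using eigenvectors_orthogonal[OF sa x(2) _ l(2)] by (auto simp: orth_in_def T_def scaleR_scaleC)
  from c(2)[OF this] have "c * norm x \<le> \<bar>l - z\<bar> * norm x"
    by (simp add: T_def x scaleR_scaleC[symmetric] scaleR_diff_left[symmetric])
  then show False using x l by (simp add: dist_real_def)
qed

definition negative_eigensystem :: "('a::complex_inner \<Rightarrow> 'a) \<Rightarrow> 'a set \<Rightarrow> bool" where
  "negative_eigensystem A B \<longleftrightarrow> finite B \<and> orthogonal_system B \<and> (\<forall>b\<in>B. \<exists>l<0. A b = l *\<^sub>R b)"

definition negative_eigenbasis :: "('a::complex_inner \<Rightarrow> 'a) \<Rightarrow> 'a set \<Rightarrow> 'a set \<Rightarrow> bool" where
  "negative_eigenbasis A V B \<longleftrightarrow> negative_eigensystem A B \<and> B \<subseteq> V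
     \<and> (\<forall>x\<in>orth_in V B. 0 \<le> Re (cinner (A x) x))"

text \<open>
  Orthogonal eigenvectors are independent, so those for the eigenvalue \<open>l\<close> are no more than the
  dimension of the kernel of \<open>A - l\<close>, which the Fredholm property makes finite.
\<close>

lemma negative_eigensystem_card_bound:
  fixes A :: "'a::chilbert_space \<Rightarrow> 'a"
  assumes A: "essentially_positive A"
  obtains N where "\<And>B. negative_eigensystem A B \<Longrightarrow> card B \<le> N"
proof -
  define L where "L = eigenvalues A \<inter> {..<0}"
  have "finite L" unfolding L_def by (rule finite_negative_eigenvalues[OF A])
  have "\<exists>F. finite F \<and> {x. A x = l *\<^sub>R x} \<subseteq> complex_vector.span F" if "l \<in> L" for l
    using essentially_positive_fredholm[OF A, of l] that
    by (auto simp: fredholm_def fin_dim_def L_def scaleR_scaleC)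
  then obtain F where F: "\<And>l. l \<in> L \<Longrightarrow> finite (F l)"
      "\<And>l. l \<in> L \<Longrightarrow> {x. A x = l *\<^sub>R x} \<subseteq> complex_vector.span (F l)"
    by metis
  have "card B \<le> (\<Sum>l\<in>L. card (F l))" if B: "negative_eigensystem A B" for B
  proof -
    have "b \<in> (\<Union>l\<in>L. B \<inter> {x. A x = l *\<^sub>R x})" if "b \<in> B" for b
    proof -
      obtain l where "l < 0" "A b = l *\<^sub>R b" "b \<noteq> 0"
        using B \<open>b \<in> B\<close> by (auto simp: negative_eigensystem_def orthogonal_system_def)
      then show ?thesis using \<open>b \<in> B\<close> by (auto simp: L_def eigenvalues_def)
    qed
    then have "B = (\<Union>l\<in>L. B \<inter> {x. A x = l *\<^sub>R x})" by blast
    then have "card B \<le> (\<Sum>l\<in>L. card (B \<inter> {x. A x = l *\<^sub>R x}))"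
      using card_UN_le[OF \<open>finite L\<close>] by metis
    also have "\<dots> \<le> (\<Sum>l\<in>L. card (F l))"
    proof (rule sum_mono)
      fix l assume "l \<in> L"
      have "complex_vector.independent (B \<inter> {x. A x = l *\<^sub>R x})"
        using B orthogonal_system_independent complex_vector.independent_mono
        unfolding negative_eigensystem_def by blast
      moreover have "B \<inter> {x. A x = l *\<^sub>R x} \<subseteq> complex_vector.span (F l)"
        using F(2)[OF \<open>l \<in> L\<close>] by blast
      ultimately show "card (B \<inter> {x. A x = l *\<^sub>R x}) \<le> card (F l)"
        using complex_vector.independent_span_bound[OF F(1)[OF \<open>l \<in> L\<close>]] by blast
    qed
    finally show ?thesis .
  qed
  with that show thesis by blast
qed

lemma closed_invariant_orth_in_eigensystem:
  assumes "selfadjoint A" "closed_invariant A V" "negative_eigensystem A B"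
  shows "closed_invariant A (orth_in V B)"
proof (rule closed_invariant_orth_in[OF assms(1,2)])
  fix b assume "b \<in> B"
  then obtain l where "A b = l *\<^sub>R b" using assms(3) by (auto simp: negative_eigensystem_def)
  with \<open>b \<in> B\<close> show "A b \<in> complex_vector.span B"
    by (simp add: scaleR_scaleC complex_vector.span_base complex_vector.span_scale)
qed

text \<open>
  Take a system of maximal cardinality. Were the form of \<open>A\<close> negative somewhere on its orthogonal
  complement, the infimum of the numerical range there would be an eigenvalue, and its eigenvector
  would enlarge the system.
\<close>

lemma negative_eigenbasis_exists:
  fixes A :: "'a::chilbert_space \<Rightarrow> 'a"
  assumes A: "essentially_positive A" and V: "closed_invariant A V"
  obtains B where "negative_eigenbasis A V B"
proof -
  have sa: "selfadjoint A" using A by (simp add: essentially_positive_def)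
  obtain N where N: "\<And>B. negative_eigensystem A B \<Longrightarrow> card B \<le> N"
    using negative_eigensystem_card_bound[OF A] by blast
  let ?P = "\<lambda>B. negative_eigensystem A B \<and> B \<subseteq> V"
  have "?P {}" by (simp add: negative_eigensystem_def orthogonal_system_def)
  moreover have "\<forall>B. ?P B \<longrightarrow> card B < Suc N" using N by (auto simp: less_Suc_eq_le)
  ultimately obtain B where B: "?P B" and max: "\<And>B'. ?P B' \<Longrightarrow> card B' \<le> card B"
    using ex_has_greatest_nat[of ?P "{}" card "Suc N"] by blast
  have W: "closed_invariant A (orth_in V B)"
    using closed_invariant_orth_in_eigensystem[OF sa V] B by blast
  have "0 \<le> Re (cinner (A x) x)" if x: "x \<in> orth_in V B" for x
  proof (rule ccontr)
    assume neg: "\<not> ?thesis"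
    then have "x \<noteq> 0" by (auto simp: selfadjointD(6)[OF sa])
    have "A ` orth_in V B \<subseteq> orth_in V B" using closed_invariantD(3)[OF W] by blast
    then obtain m where m: "m * (norm x)\<^sup>2 \<le> Re (cinner (A x) x)"
        "\<not> bounded_below_on (orth_in V B) (\<lambda>x. A x - complex_of_real m *\<^sub>C x)"
      using numerical_infimum_not_bounded_below[OF sa closed_invariantD(1)[OF W] _ x \<open>x \<noteq> 0\<close>] by blast
    have "m * (norm x)\<^sup>2 < 0" using m(1) neg by linarith
    then have "m < 0" by (simp add: mult_less_0_iff)
    then obtain e where e: "e \<in> orth_in V B" "e \<noteq> 0" "A e = m *\<^sub>R e"
      using approximate_eigenvalue_imp_eigenvector[OF A less_imp_le W m(2)] by blast
    have "e \<notin> B" using e by (auto simp: orth_in_def)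
    have "negative_eigensystem A (insert e B)"
      using B e \<open>m < 0\<close> cinner_eq_zero_commute
      by (auto simp: negative_eigensystem_def orthogonal_system_def pairwise_insert orth_in_def)
    then have "?P (insert e B)" using B e by (auto simp: orth_in_def)
    from max[OF this] show False
      using \<open>e \<notin> B\<close> B by (simp add: negative_eigensystem_def)
  qed
  with B that show thesis by (auto simp: negative_eigenbasis_def)
qed

text \<open>
  The next two facts turn a value of the form into a spectral value on the same side of \<open>r\<close>, namely an
  end of the numerical range; the second is the first for \<open>- A\<close>.
\<close>

lemma negative_form_in_op_spectrum:
  fixes A :: "'a::chilbert_space \<Rightarrow> 'a"
  assumes A: "selfadjoint A" and V: "closed_invariant A V"
    and x: "x \<in> V" "x \<noteq> 0" "Re (cinner (A x) x) \<le> r * (norm x)\<^sup>2"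
  obtains m where "m \<le> r" "complex_of_real m \<in> op_spectrum V A"
proof -
  have "A ` V \<subseteq> V" using closed_invariantD(3)[OF V] by blast
  then obtain m where "m * (norm x)\<^sup>2 \<le> Re (cinner (A x) x)"
      "\<not> bounded_below_on V (\<lambda>x. A x - complex_of_real m *\<^sub>C x)"
    using numerical_infimum_not_bounded_below[OF A closed_invariantD(1)[OF V] _ x(1,2)] by blast
  moreover from this x(3) have "m * (norm x)\<^sup>2 \<le> r * (norm x)\<^sup>2" by linarith
  then have "m \<le> r" using x(2) by simp
  ultimately show thesis using that op_spectrum_iff[OF A V] by blast
qed

lemma positive_form_in_op_spectrum:
  fixes A :: "'a::chilbert_space \<Rightarrow> 'a"
  assumes A: "selfadjoint A" and V: "closed_invariant A V"
    and x: "x \<in> V" "x \<noteq> 0" "r * (norm x)\<^sup>2 \<le> Re (cinner (A x) x)"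
  obtains m where "r \<le> m" "complex_of_real m \<in> op_spectrum V A"
proof -
  have bl: "bounded_linear (\<lambda>x. - A x)" by (rule bounded_linear_minus[OF selfadjointD(1)[OF A]])
  have A': "selfadjoint (\<lambda>x. - A x)"
    using bl selfadjointD(2,3)[OF A] by (simp add: selfadjoint_def bounded_clinear_def cinner_simps)
  have V': "closed_invariant (\<lambda>x. - A x) V"
    using V by (auto simp: closed_invariant_def complex_vector.subspace_neg)
  obtain m where m: "m \<le> - r" "complex_of_real m \<in> op_spectrum V (\<lambda>x. - A x)"
    by (rule negative_form_in_op_spectrum[OF A' V' x(1,2), of "- r"]) (use x(3) in \<open>simp_all add: cinner_minus_left\<close>)
  have "norm (A x - complex_of_real (- m) *\<^sub>C x) = norm (- A x - complex_of_real m *\<^sub>C x)" for x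
    using norm_minus_cancel[of "A x - complex_of_real (- m) *\<^sub>C x"] by (simp add: complex_vector.scale_minus_left)
  then have "complex_of_real (- m) \<in> op_spectrum V A"
    using m(2) unfolding op_spectrum_iff[OF A V] op_spectrum_iff[OF A' V'] bounded_below_on_def by simp
  with m(1) that[of "- m"] show thesis by simp
qed

lemma closed_invariant_span_eigensystem:
  assumes A: "selfadjoint A" and B: "negative_eigensystem A B"
  shows "closed_invariant A (complex_vector.span B)"
proof -
  have "A x \<in> complex_vector.span B" if "x \<in> complex_vector.span B" for x
    using that
  proof (induction rule: complex_vector.span_induct)
    case base
    show ?case
      by (auto simp: complex_vector.subspace_def selfadjointD[OF A] complex_vector.span_zero
          intro: complex_vector.span_add complex_vector.span_scale)
  next
    case (step b)
    then obtain l where "A b = l *\<^sub>R b" using B by (auto simp: negative_eigensystem_def)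
    with step show ?case
      by (simp add: scaleR_scaleC complex_vector.span_base complex_vector.span_scale)
  qed
  then show ?thesis
    using B closed_span_orthogonal_system
    by (auto simp: closed_invariant_def negative_eigensystem_def)
qed

text \<open>
  In the basis \<open>B\<close> a shift is diagonal, and the least absolute value of a diagonal entry is a lower
  bound for it.
\<close>

lemma op_spectrum_span_eigensystem:
  fixes A :: "'a::chilbert_space \<Rightarrow> 'a"
  assumes A: "selfadjoint A" and B: "negative_eigensystem A B"
  shows "op_spectrum (complex_vector.span B) A \<subseteq> complex_of_real ` {..<0}"
proof
  fix z assume z: "z \<in> op_spectrum (complex_vector.span B) A"
  obtain l where l: "\<And>b. b \<in> B \<Longrightarrow> l b < 0 \<and> A b = l b *\<^sub>R b"
    using B unfolding negative_eigensystem_def by metis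
  have fin: "finite B" and orth: "orthogonal_system B" using B by (auto simp: negative_eigensystem_def)
  show "z \<in> complex_of_real ` {..<0}"
  proof (rule ccontr)
    assume "z \<notin> complex_of_real ` {..<0}"
    then have pos: "norm (of_real (l b) - z) > 0" if "b \<in> B" for b using l[OF that] by auto
    \<comment> \<open>The entry \<open>1\<close> covers empty \<open>B\<close>.\<close>
    define c where "c = Min (insert 1 ((\<lambda>b. norm (of_real (l b) - z)) ` B))"
    have c: "c > 0" "\<And>b. b \<in> B \<Longrightarrow> c \<le> norm (of_real (l b) - z)"
      using fin pos by (auto simp: c_def)
    have "c * norm x \<le> norm (A x - z *\<^sub>C x)" if x: "x \<in> complex_vector.span B" for x
    proof -
      obtain u where u: "x = (\<Sum>b\<in>B. u b *\<^sub>C b)"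
        using x unfolding complex_vector.span_finite[OF fin] by blast
      have pw: "pairwise (\<lambda>b d. cinner (v b *\<^sub>C b) (v d *\<^sub>C d) = 0) B" for v
        using orth by (auto simp: orthogonal_system_def pairwise_def cinner_simps)
      have "A x - z *\<^sub>C x = (\<Sum>b\<in>B. ((of_real (l b) - z) * u b) *\<^sub>C b)"
        unfolding u selfadjointD(8)[OF A] complex_vector.scale_sum_right sum_subtractf[symmetric]
      proof (rule sum.cong[OF refl])
        fix b assume "b \<in> B"
        then have "A (u b *\<^sub>C b) - z *\<^sub>C u b *\<^sub>C b = (u b * of_real (l b) - z * u b) *\<^sub>C b"
          using l by (simp add: selfadjointD(2)[OF A] scaleR_scaleC scaleC_scaleC
              complex_vector.scale_left_diff_distrib)
        also have "u b * of_real (l b) - z * u b = (of_real (l b) - z) * u b"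
          by (simp add: algebra_simps)
        finally show "A (u b *\<^sub>C b) - z *\<^sub>C u b *\<^sub>C b = ((of_real (l b) - z) * u b) *\<^sub>C b" .
      qed
      then have "(norm (A x - z *\<^sub>C x))\<^sup>2 = (\<Sum>b\<in>B. (norm (((of_real (l b) - z) * u b) *\<^sub>C b))\<^sup>2)"
        by (simp add: norm_orthogonal_sum_power2[OF fin pw])
      also have "\<dots> \<ge> (\<Sum>b\<in>B. c\<^sup>2 * (norm (u b *\<^sub>C b))\<^sup>2)"
      proof (rule sum_mono)
        fix b assume "b \<in> B"
        then have "(c * norm (u b *\<^sub>C b))\<^sup>2 \<le> (norm (of_real (l b) - z) * norm (u b *\<^sub>C b))\<^sup>2"
          using c by (intro power_mono mult_right_mono) auto
        then show "c\<^sup>2 * (norm (u b *\<^sub>C b))\<^sup>2 \<le> (norm (((of_real (l b) - z) * u b) *\<^sub>C b))\<^sup>2"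
          by (simp add: norm_scaleC norm_mult power_mult_distrib mult_ac)
      qed
      also have "(\<Sum>b\<in>B. c\<^sup>2 * (norm (u b *\<^sub>C b))\<^sup>2) = (c * norm x)\<^sup>2"
        by (simp add: u norm_orthogonal_sum_power2[OF fin pw] power_mult_distrib sum_distrib_left)
      finally show ?thesis by (rule power2_le_imp_le) simp
    qed
    then show False
      using z c(1) op_spectrum_iff[OF A closed_invariant_span_eigensystem[OF A B]]
      unfolding bounded_below_on_def by blast
  qed
qed

text \<open>For \<open>l < 0\<close> the form of \<open>A - l\<close> is at least \<open>- l * (norm x)\<^sup>2\<close>, which bounds \<open>A - l\<close> below.\<close>

lemma nonneg_form_op_spectrum:
  fixes A :: "'a::chilbert_space \<Rightarrow> 'a"
  assumes A: "selfadjoint A" and V: "closed_invariant A V"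
    and nonneg: "\<And>x. x \<in> V \<Longrightarrow> 0 \<le> Re (cinner (A x) x)"
  shows "op_spectrum V A \<inter> complex_of_real ` {..<0} = {}"
proof -
  have "bounded_below_on V (\<lambda>x. A x - complex_of_real l *\<^sub>C x)" if "l < 0" for l
  proof -
    have "- l * norm x \<le> norm (A x - complex_of_real l *\<^sub>C x)" if "x \<in> V" for x
    proof (cases "x = 0")
      case False
      have "- l * (norm x)\<^sup>2 \<le> Re (cinner (A x - complex_of_real l *\<^sub>C x) x)"
        using nonneg[OF that] by (simp add: cinner_simps Re_cinner_self)
      also have "\<dots> \<le> norm (A x - complex_of_real l *\<^sub>C x) * norm x"
        using complex_Re_le_cmod cauchy_schwarz order_trans by blast
      finally have "(- l * norm x) * norm x \<le> norm (A x - complex_of_real l *\<^sub>C x) * norm x"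
        by (simp add: power2_eq_square mult_ac)
      then show ?thesis by (rule mult_right_le_imp_le) (use False in simp)
    qed simp
    moreover have "- l > 0" using that by simp
    ultimately show ?thesis unfolding bounded_below_on_def by blast
  qed
  then show ?thesis using op_spectrum_iff[OF A V] by auto
qed

lemma negative_eigenbasis_spectral_subspace:
  fixes A :: "'a::chilbert_space \<Rightarrow> 'a"
  assumes A: "selfadjoint A" and V: "closed_invariant A V" and B: "negative_eigenbasis A V B"
  shows "is_spectral_subspace V A (complex_of_real ` {..<0}) (complex_vector.span B)"
proof -
  let ?M = "complex_vector.span B" and ?Z = "complex_of_real ` {..<0}"
  have B': "negative_eigensystem A B" "B \<subseteq> V" using B by (auto simp: negative_eigenbasis_def)
  have M: "closed_invariant A ?M" by (rule closed_invariant_span_eigensystem[OF A B'(1)])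
  have sub: "?M \<subseteq> V" by (rule complex_vector.span_minimal[OF B'(2) closed_invariantD(1)[OF V]])
  have N: "closed_invariant A (orth_in V ?M)"
    unfolding orth_in_span by (rule closed_invariant_orth_in_eigensystem[OF A V B'(1)])
  have "op_spectrum ?M A \<subseteq> ?Z" by (rule op_spectrum_span_eigensystem[OF A B'(1)])
  moreover have "op_spectrum (orth_in V ?M) A \<inter> ?Z = {}"
    by (rule nonneg_form_op_spectrum[OF A N]) (use B in \<open>auto simp: orth_in_span negative_eigenbasis_def\<close>)
  ultimately have "op_spectrum ?M A = op_spectrum V A \<inter> ?Z"
      "op_spectrum (orth_in V ?M) A = op_spectrum V A - ?Z"
    unfolding op_spectrum_split[OF A V M sub] by blast+
  then show ?thesis
    using M N sub unfolding is_spectral_subspace_def closed_invariant_def by blast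
qed

text \<open>
  For any spectral subspace \<open>M\<close> the form of \<open>A\<close> is negative on \<open>M\<close> and nonnegative on its
  complement, since otherwise an end of the numerical range would be a spectral value of the
  wrong sign. The part of a negative eigenvector orthogonal to \<open>M\<close> has the same eigenvalue, hence is
  zero by the sign of the form; so \<open>M\<close> contains the span of \<open>B\<close>. On the part of \<open>M\<close> orthogonal to \<open>B\<close> the form is nonnegative as
  well, so this part is zero.
\<close>

lemma spectral_subspace_eq_span:
  fixes A :: "'a::chilbert_space \<Rightarrow> 'a"
  assumes A: "selfadjoint A" and V: "closed_invariant A V" and B: "negative_eigenbasis A V B"
    and M: "is_spectral_subspace V A (complex_of_real ` {..<0}) M"
  shows "M = complex_vector.span B"
proof
  have B': "negative_eigensystem A B" "B \<subseteq> V" using B by (auto simp: negative_eigenbasis_def)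
  have MI: "closed_invariant A M" and sub: "M \<subseteq> V" and NI: "closed_invariant A (orth_in V M)"
    and spM: "op_spectrum M A \<subseteq> complex_of_real ` {..<0}"
    and spN: "op_spectrum (orth_in V M) A \<inter> complex_of_real ` {..<0} = {}"
    using M closed_invariantD(1,2)[OF V]
    by (auto simp: is_spectral_subspace_def closed_invariant_def intro: csubspace_orth_in closed_orth_in)
  have neg: "Re (cinner (A x) x) < 0" if x: "x \<in> M" "x \<noteq> 0" for x
  proof (rule ccontr)
    assume "\<not> ?thesis"
    then obtain m where "0 \<le> m" "complex_of_real m \<in> op_spectrum M A"
      using positive_form_in_op_spectrum[OF A MI x, of 0] by auto
    with spM show False by auto
  qed
  have eig: "x = 0" if x: "x \<in> orth_in V M" "A x = l *\<^sub>R x" and l: "l < 0" for x l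
  proof (rule ccontr)
    assume "x \<noteq> 0"
    then obtain m where "m \<le> l" "complex_of_real m \<in> op_spectrum (orth_in V M) A"
      by (rule negative_form_in_op_spectrum[OF A NI x(1), of l])
        (simp_all add: x cinner_scaleR_left Re_cinner_self)
    with spN l show False by auto
  qed
  have "b \<in> M" if b: "b \<in> B" for b
  proof -
    obtain l where l: "l < 0" "A b = l *\<^sub>R b" using B' b by (auto simp: negative_eigensystem_def)
    obtain a d where ad: "a \<in> M" "d \<in> orth_in V M" "b = a + d"
      using closed_invariant_split[OF V MI sub] b B'(2) by blast
    have "A a - complex_of_real l *\<^sub>C a \<in> M" "A d - complex_of_real l *\<^sub>C d \<in> orth_in V M"
      using closed_invariant_shift_mem MI NI ad by blast+
    then have "cinner (A d - complex_of_real l *\<^sub>C d) (A a - complex_of_real l *\<^sub>C a) = 0"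
      by (auto simp: orth_in_def)
    moreover have "A d - complex_of_real l *\<^sub>C d = - (A a - complex_of_real l *\<^sub>C a)"
      using l(2) unfolding ad(3) selfadjointD(4)[OF A]
      by (simp add: scaleR_scaleC[symmetric] scaleR_add_right algebra_simps)
    ultimately have "A d - complex_of_real l *\<^sub>C d = 0"
      by (simp only: cinner_minus_left neg_equal_0_iff_equal cinner_self_eq_zero minus_zero)
    then have "A d = l *\<^sub>R d" by (simp add: scaleR_scaleC)
    then have "d = 0" using eig ad(2) l(1) by blast
    with ad show ?thesis by simp
  qed
  then show span: "complex_vector.span B \<subseteq> M"
    by (intro complex_vector.span_minimal closed_invariantD(1)[OF MI]) blast
  show "M \<subseteq> complex_vector.span B"
  proof
    fix x assume x: "x \<in> M"
    obtain a d where ad: "a \<in> complex_vector.span B" "d \<in> orth_in M (complex_vector.span B)" "x = a + d"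
      using closed_invariant_split[OF MI closed_invariant_span_eigensystem[OF A B'(1)] span x] .
    then have "d \<in> M" "d \<in> orth_in V B"
      using sub orth_in_span[of M B] by (auto simp: orth_in_def)
    then have "d = 0" using neg[of d] B by (force simp: negative_eigenbasis_def)
    with ad show "x \<in> complex_vector.span B" by simp
  qed
qed

theorem morse_index_eq_card:
  fixes A :: "'a::chilbert_space \<Rightarrow> 'a"
  assumes A: "selfadjoint A" and V: "closed_invariant A V" and B: "negative_eigenbasis A V B"
  shows "morse_index V A = card B"
proof -
  have "spectral_subspace V A (complex_of_real ` {..<0}) = complex_vector.span B"
    unfolding spectral_subspace_def
    using negative_eigenbasis_spectral_subspace[OF A V B] spectral_subspace_eq_span[OF A V B]
    by (rule the_equality)
  moreover have "complex_vector.independent B"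
    by (rule orthogonal_system_independent)
      (use B in \<open>simp add: negative_eigenbasis_def negative_eigensystem_def\<close>)
  ultimately show ?thesis
    by (simp add: morse_index_def complex_vector.dim_eq_card_independent)
qed

section \<open>Additivity of the Morse index\<close>

definition orthogonal_decomposition :: "'i set \<Rightarrow> ('i \<Rightarrow> 'a::complex_inner set) \<Rightarrow> 'a set \<Rightarrow> bool" where
  "orthogonal_decomposition I U V \<longleftrightarrow> finite I
     \<and> (\<forall>i\<in>I. complex_vector.subspace (U i) \<and> U i \<subseteq> V)
     \<and> pairwise (\<lambda>i j. \<forall>x\<in>U i. \<forall>y\<in>U j. cinner x y = 0) I
     \<and> (\<forall>x\<in>V. \<exists>f. (\<forall>i\<in>I. f i \<in> U i) \<and> x = (\<Sum>i\<in>I. f i))"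

text \<open>Each summand is closed as the orthogonal complement of the others in \<open>V\<close>.\<close>

lemma orthogonal_decomposition_closed:
  assumes dec: "orthogonal_decomposition I U V" and "closed V" and i: "i \<in> I"
  shows "closed (U i)"
proof -
  let ?O = "\<Union>j\<in>I - {i}. U j"
  have "U i = orth_in V ?O"
  proof
    show "U i \<subseteq> orth_in V ?O"
      using dec i by (auto simp: orthogonal_decomposition_def orth_in_def pairwise_def)
    show "orth_in V ?O \<subseteq> U i"
    proof
      fix x assume x: "x \<in> orth_in V ?O"
      then obtain f where f: "\<forall>j\<in>I. f j \<in> U j" "x = (\<Sum>j\<in>I. f j)"
        using dec by (auto simp: orthogonal_decomposition_def orth_in_def)
      have "f j = 0" if j: "j \<in> I - {i}" for j
      proof -
        have "0 = cinner x (f j)" using x f j by (auto simp: orth_in_def)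
        also have "\<dots> = (\<Sum>k\<in>I. if k = j then cinner (f j) (f j) else 0)"
          unfolding f(2) cinner_sum_left
          by (rule sum.cong) (use dec f j in \<open>auto simp: orthogonal_decomposition_def pairwise_def\<close>)
        also have "\<dots> = cinner (f j) (f j)" using dec j by (simp add: orthogonal_decomposition_def)
        finally show ?thesis by simp
      qed
      then have "x = f i"
        unfolding f(2) using dec i by (simp add: orthogonal_decomposition_def sum.remove[of I i])
      then show "x \<in> U i" using f i by simp
    qed
  qed
  then show ?thesis using closed_orth_in[OF \<open>closed V\<close>] by simp
qed

text \<open>
  The union of negative eigenbases of the summands is one of \<open>V\<close>: by orthogonality and invariance the
  form of \<open>A\<close> at a vector is the sum of its values at the components.
\<close>

theorem morse_index_orthogonal_decomposition:
  fixes A :: "'a::chilbert_space \<Rightarrow> 'a"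
  assumes A: "essentially_positive A" and "closed_invariant A V"
    and dec: "orthogonal_decomposition I U V" and inv: "\<And>i. i \<in> I \<Longrightarrow> A ` U i \<subseteq> U i"
  shows "morse_index V A = (\<Sum>i\<in>I. morse_index (U i) A)"
proof -
  have sa: "selfadjoint A" using A by (simp add: essentially_positive_def)
  have fin: "finite I" and pw: "pairwise (\<lambda>i j. \<forall>x\<in>U i. \<forall>y\<in>U j. cinner x y = 0) I"
    using dec by (auto simp: orthogonal_decomposition_def)
  have U: "closed_invariant A (U i)" if "i \<in> I" for i
    using orthogonal_decomposition_closed[OF dec closed_invariantD(2)[OF assms(2)] that] inv[OF that] dec that
    by (simp add: closed_invariant_def orthogonal_decomposition_def)
  have "\<exists>B. negative_eigenbasis A (U i) B" if "i \<in> I" for i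
    using negative_eigenbasis_exists[OF A U[OF that]] by blast
  then obtain B where B: "\<And>i. i \<in> I \<Longrightarrow> negative_eigenbasis A (U i) (B i)" by metis
  have BU: "B i \<subseteq> U i" "finite (B i)" "orthogonal_system (B i)" if "i \<in> I" for i
    using B[OF that] by (auto simp: negative_eigenbasis_def negative_eigensystem_def)
  have disj: "B i \<inter> B j = {}" if ij: "i \<in> I" "j \<in> I" "i \<noteq> j" for i j
  proof (rule ccontr)
    assume "B i \<inter> B j \<noteq> {}"
    then obtain b where b: "b \<in> B i" "b \<in> B j" by blast
    then have "b \<in> U i" "b \<in> U j" using BU(1) ij by blast+
    then have "cinner b b = 0" using pw ij unfolding pairwise_def by blast
    then show False using b(1) BU(3)[OF ij(1)] by (simp add: orthogonal_system_def)
  qed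
  have "negative_eigenbasis A V (\<Union>i\<in>I. B i)"
    unfolding negative_eigenbasis_def negative_eigensystem_def
  proof (intro conjI ballI)
    show "finite (\<Union>i\<in>I. B i)" using fin BU(2) by blast
    have "cinner b c = 0" if "i \<in> I" "j \<in> I" "b \<in> B i" "c \<in> B j" "b \<noteq> c" for i j b c
    proof (cases "i = j")
      case True
      then show ?thesis using BU(3) that by (auto simp: orthogonal_system_def pairwise_def)
    next
      case False
      have "b \<in> U i" "c \<in> U j" using BU(1) that by blast+
      then show ?thesis using False pw that(1,2) by (auto simp: pairwise_def)
    qed
    then show "orthogonal_system (\<Union>i\<in>I. B i)"
      using BU(3) unfolding orthogonal_system_def pairwise_def by blast
    show "\<exists>l<0. A b = l *\<^sub>R b" if "b \<in> (\<Union>i\<in>I. B i)" for b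
      using that B unfolding negative_eigenbasis_def negative_eigensystem_def by blast
    show "(\<Union>i\<in>I. B i) \<subseteq> V" using BU(1) dec unfolding orthogonal_decomposition_def by blast
    show "0 \<le> Re (cinner (A x) x)" if x: "x \<in> orth_in V (\<Union>i\<in>I. B i)" for x
    proof -
      have "\<exists>f. (\<forall>i\<in>I. f i \<in> U i) \<and> x = (\<Sum>i\<in>I. f i)"
        using dec x by (simp add: orthogonal_decomposition_def orth_in_def)
      then obtain f where f: "\<And>i. i \<in> I \<Longrightarrow> f i \<in> U i" "x = (\<Sum>i\<in>I. f i)"
        by blast
      have proj: "cinner x u = cinner (f i) u" if i: "i \<in> I" and u: "u \<in> U i" for i u
      proof -
        have "cinner x u = (\<Sum>j\<in>I. if j = i then cinner (f i) u else 0)"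
          unfolding f(2) cinner_sum_left
          by (rule sum.cong) (use pw f(1) i u in \<open>auto simp: pairwise_def\<close>)
        then show ?thesis using fin i by simp
      qed
      have "f i \<in> orth_in (U i) (B i)" if i: "i \<in> I" for i
      proof -
        have "cinner (f i) b = 0" if b: "b \<in> B i" for b
          using proj[OF i, of b] BU(1)[OF i] x i b unfolding orth_in_def by auto
        then show ?thesis using f(1)[OF i] by (simp add: orth_in_def)
      qed
      then have nonneg: "0 \<le> Re (cinner (A (f i)) (f i))" if "i \<in> I" for i
        using B[OF that] that by (simp add: negative_eigenbasis_def)
      have "cinner (A x) x = (\<Sum>i\<in>I. cinner (A x) (f i))"
        by (subst (2) f(2)) (rule cinner_sum_right)
      also have "\<dots> = (\<Sum>i\<in>I. cinner (A (f i)) (f i))"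
      proof (rule sum.cong[OF refl])
        fix i assume i: "i \<in> I"
        have "cinner (A x) (f i) = cinner x (A (f i))" by (rule selfadjointD(3)[OF sa])
        also have "\<dots> = cinner (f i) (A (f i))"
          using inv[OF i] f(1)[OF i] by (intro proj[OF i]) blast
        finally show "cinner (A x) (f i) = cinner (A (f i)) (f i)"
          by (simp only: selfadjointD(3)[OF sa])
      qed
      finally show ?thesis using nonneg by (simp add: sum_nonneg)
    qed
  qed
  from morse_index_eq_card[OF sa assms(2) this]
  have "morse_index V A = (\<Sum>i\<in>I. card (B i))"
    using fin BU(2) disj by (subst (asm) card_UN_disjoint) auto
  also have "\<dots> = (\<Sum>i\<in>I. morse_index (U i) A)"
    by (rule sum.cong) (use morse_index_eq_card[OF sa U B] in auto)
  finally show ?thesis .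
qed

section \<open>The isotypic decomposition of a dihedral representation\<close>

lemma bounded_clinearD:
  assumes "bounded_clinear T"
  shows "T (x + y) = T x + T y" "T 0 = 0" "T (c *\<^sub>C x) = c *\<^sub>C T x" "T (r *\<^sub>R x) = r *\<^sub>R T x"
    "T (sum f I) = (\<Sum>i\<in>I. T (f i))"
proof -
  interpret bounded_linear T using assms by (simp add: bounded_clinear_def)
  show "T (x + y) = T x + T y" "T 0 = 0" "T (r *\<^sub>R x) = r *\<^sub>R T x" "T (sum f I) = (\<Sum>i\<in>I. T (f i))"
    by (rule add zero scaleR sum)+
  show "T (c *\<^sub>C x) = c *\<^sub>C T x" using assms by (simp add: bounded_clinear_def)
qed

lemma unitary_compose: "unitary S \<Longrightarrow> unitary R \<Longrightarrow> unitary (\<lambda>x. S (R x))"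
  using comp_surj[of R S]
  by (simp add: unitary_def bounded_clinear_def bounded_linear_compose comp_def)

lemma unitary_funpow:
  assumes "unitary R" shows "unitary (R ^^ h)"
proof (induction h)
  case 0
  show ?case by (simp add: unitary_def bounded_clinear_def id_def bounded_linear_ident)
next
  case (Suc h)
  with unitary_compose[OF assms Suc] show ?case by (simp add: comp_def)
qed

definition eigenspace :: "('a::complex_inner \<Rightarrow> 'a) \<Rightarrow> complex \<Rightarrow> 'a set" where
  "eigenspace R w = {x. R x = w *\<^sub>C x}"

lemma csubspace_eigenspace:
  assumes "bounded_clinear R" shows "complex_vector.subspace (eigenspace R w)"
  using bounded_clinearD[OF assms]
  by (simp add: complex_vector.subspace_def eigenspace_def scaleC_add_right scaleC_scaleC mult.commute)

lemma unitary_eigenspaces_orthogonal: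
  assumes R: "unitary R" and x: "x \<in> eigenspace R v" and y: "y \<in> eigenspace R w"
    and "norm w = 1" "v \<noteq> w"
  shows "cinner x y = 0"
proof -
  have "w * cnj w = 1" using \<open>norm w = 1\<close> complex_norm_square[of w] by simp
  have "cinner x y = cinner (R x) (R y)" using R by (simp add: unitary_def)
  also have "\<dots> = v * cnj w * cinner x y"
    using x y by (simp add: eigenspace_def cinner_scaleC_left cinner_scaleC_right)
  finally have "w * cinner x y = (w * cnj w) * v * cinner x y" by (simp add: mult_ac)
  then have "(w - v) * cinner x y = 0"
    using \<open>w * cnj w = 1\<close> by (simp add: left_diff_distrib)
  then show ?thesis using \<open>v \<noteq> w\<close> by simp
qed

lemma zeta_power: "zeta n ^ j = exp (2 * of_real pi * \<i> * of_nat j / of_nat n)"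
  by (simp add: zeta_def mult_ac flip: exp_of_nat_mult)

lemma zeta_power_eq_iff:
  "n \<ge> 1 \<Longrightarrow> zeta n ^ j = zeta n ^ k \<longleftrightarrow> j mod n = k mod n"
  unfolding zeta_power by (rule complex_root_unity_eq)

lemma norm_zeta: "norm (zeta n) = 1"
  by (simp add: zeta_def norm_exp_eq_Re)

lemma zeta_nonzero: "zeta n \<noteq> 0"
  by (simp add: zeta_def)

lemma zeta_power_mirror: "n \<ge> 1 \<Longrightarrow> k \<le> n \<Longrightarrow> zeta n ^ (n - k) = inverse (zeta n ^ k)"
  using zeta_power_eq_iff[of n n 0]
  by (simp add: zeta_nonzero power_diff field_simps)

text \<open>
  For a unitary \<open>R\<close> with \<open>R ^^ n = id\<close> and an \<open>n\<close>-th root of unity \<open>w\<close> this is the orthogonal projection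
  to \<open>eigenspace R w\<close>: the average over the cyclic group generated by \<open>inverse w *\<^sub>C R\<close>.
\<close>

definition root_projection :: "nat \<Rightarrow> ('a::complex_inner \<Rightarrow> 'a) \<Rightarrow> complex \<Rightarrow> 'a \<Rightarrow> 'a" where
  "root_projection n R w x = (1 / of_nat n) *\<^sub>C (\<Sum>j<n. inverse w ^ j *\<^sub>C (R ^^ j) x)"

text \<open>Applying \<open>R\<close> shifts the terms of the average cyclically and multiplies them by \<open>w\<close>.\<close>

lemma root_projection_in_eigenspace:
  assumes R: "bounded_clinear R" "R ^^ n = id" and w: "w ^ n = 1"
  shows "root_projection n R w x \<in> eigenspace R w"
proof -
  have "w \<noteq> 0" if "n > 0" using w that by (auto simp: power_0_left)
  define f where "f j = inverse w ^ j *\<^sub>C (R ^^ j) x" for j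
  have "f n = f 0" using R(2) w by (simp add: f_def power_inverse)
  have shift: "R (f j) = w *\<^sub>C f (Suc j)" if "n > 0" for j
    using \<open>n > 0 \<Longrightarrow> w \<noteq> 0\<close>[OF that]
    by (simp add: f_def bounded_clinearD[OF R(1)] scaleC_scaleC mult.assoc[symmetric])
  have "R (\<Sum>j<n. f j) = w *\<^sub>C (\<Sum>j<n. f (Suc j))"
    by (cases "n = 0") (simp_all add: bounded_clinearD[OF R(1)] shift complex_vector.scale_sum_right)
  also have "(\<Sum>j<n. f (Suc j)) = (\<Sum>j<n. f j)"
    using sum.lessThan_Suc_shift[of f n] sum.lessThan_Suc[of f n] \<open>f n = f 0\<close> by (simp add: add.commute)
  finally show ?thesis
    by (simp add: eigenspace_def root_projection_def f_def[symmetric] bounded_clinearD[OF R(1)]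
        scaleC_scaleC mult.commute)
qed

text \<open>Summed over all roots of unity, the coefficients of \<open>(R ^^ j) x\<close> with \<open>j \<noteq> 0\<close> cancel.\<close>

lemma sum_root_projections:
  assumes "n \<ge> 1"
  shows "(\<Sum>k<n. root_projection n R (zeta n ^ k) x) = x"
proof -
  have coeff: "(\<Sum>k<n. inverse (zeta n ^ k) ^ j) = (if j = 0 then of_nat n else 0)" if "j < n" for j
  proof (cases "j = 0")
    case False
    define v where "v = inverse (zeta n ^ j)"
    have "zeta n ^ n = 1" using zeta_power_eq_iff[OF assms, of n 0] by simp
    then have "v ^ n = 1"
      unfolding v_def by (metis inverse_1 power_inverse power_mult mult.commute power_one)
    moreover have "v \<noteq> 1"
      using zeta_power_eq_iff[OF assms, of j 0] False that unfolding v_def by simp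
    moreover have "inverse (zeta n ^ k) ^ j = v ^ k" for k
      by (simp add: v_def power_inverse mult.commute flip: power_mult)
    ultimately show ?thesis using False geometric_sum[of v n] by simp
  qed simp
  have "(\<Sum>k<n. root_projection n R (zeta n ^ k) x)
      = (1 / of_nat n) *\<^sub>C (\<Sum>k<n. \<Sum>j<n. inverse (zeta n ^ k) ^ j *\<^sub>C (R ^^ j) x)"
    by (simp add: root_projection_def complex_vector.scale_sum_right)
  also have "\<dots> = (1 / of_nat n) *\<^sub>C (\<Sum>j<n. (\<Sum>k<n. inverse (zeta n ^ k) ^ j) *\<^sub>C (R ^^ j) x)"
    by (subst sum.swap) (simp add: complex_vector.scale_sum_left)
  also have "(\<Sum>j<n. (\<Sum>k<n. inverse (zeta n ^ k) ^ j) *\<^sub>C (R ^^ j) x)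
      = (\<Sum>j<n. if j = 0 then of_nat n *\<^sub>C x else 0)"
    by (rule sum.cong) (auto simp: coeff)
  also have "(1 / of_nat n) *\<^sub>C \<dots> = x"
    using assms by (simp add: scaleC_scaleC)
  finally show ?thesis .
qed

text \<open>
  In the cases \<open>k = 0\<close> and \<open>2 * k = n\<close>, where \<open>F_iso\<close> is a single eigenspace, the two
  eigenvalues coincide.
\<close>

lemma F_iso_eq_sum_eigenspaces:
  assumes "n \<ge> 1" "k \<le> n div 2" and R: "bounded_clinear R"
  shows "F_iso n R k = {x + y | x y. x \<in> eigenspace R (zeta n ^ k) \<and> y \<in> eigenspace R (inverse (zeta n ^ k))}"
proof -
  have E: "E_rot n R (int k) = eigenspace R (zeta n ^ k)"
      "E_rot n R (- int k) = eigenspace R (inverse (zeta n ^ k))"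
    by (simp_all add: E_rot_def eigenspace_def power_int_minus)
  show ?thesis
  proof (cases "1 \<le> k \<and> k \<le> (n - 1) div 2")
    case False
    then have "k = 0 \<or> n - k = k" using assms(2) by linarith
    then have "zeta n ^ k = inverse (zeta n ^ k)"
      using zeta_power_mirror[OF assms(1), of k] assms(2) by auto
    then have "{x + y | x y. x \<in> eigenspace R (zeta n ^ k) \<and> y \<in> eigenspace R (inverse (zeta n ^ k))}
        = {x + y | x y. x \<in> eigenspace R (zeta n ^ k) \<and> y \<in> eigenspace R (zeta n ^ k)}" by simp
    also have "\<dots> = eigenspace R (zeta n ^ k)"
    proof -
      have "\<exists>u v. x = u + v \<and> u \<in> eigenspace R (zeta n ^ k) \<and> v \<in> eigenspace R (zeta n ^ k)"
        if "x \<in> eigenspace R (zeta n ^ k)" for x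
        using that complex_vector.subspace_0[OF csubspace_eigenspace[OF R]]
        by (intro exI[of _ x] exI[of _ 0]) simp
      then show ?thesis
        using complex_vector.subspace_add[OF csubspace_eigenspace[OF R]] by blast
    qed
    finally show ?thesis using False by (simp add: F_iso_def E)
  qed (simp add: F_iso_def E)
qed

lemma csubspace_F_iso:
  assumes "n \<ge> 1" "k \<le> n div 2" "bounded_clinear R"
  shows "complex_vector.subspace (F_iso n R k)"
  unfolding F_iso_eq_sum_eigenspaces[OF assms]
  by (intro complex_vector.subspace_sums csubspace_eigenspace assms)

text \<open>
  The eigenvalues in \<open>F_iso n R j\<close> and \<open>F_iso n R k\<close> differ, since \<open>j + k\<close> and the distance of
  \<open>j\<close> and \<open>k\<close> lie strictly between \<open>0\<close> and \<open>n\<close>. The eigenvalues \<open>zeta n ^ k\<close> and \<open>zeta n ^ (n - k)\<close> are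
  inverse to each other, so the components of \<open>x\<close> are collected along \<open>min k (n - k)\<close>.
\<close>

lemma F_iso_decomposition:
  assumes "n \<ge> 1" and R: "unitary R" "R ^^ n = id"
  shows "orthogonal_decomposition {0..n div 2} (F_iso n R) UNIV"
  unfolding orthogonal_decomposition_def
proof (intro conjI ballI)
  have Rl: "bounded_clinear R" using R by (simp add: unitary_def)
  note F = F_iso_eq_sum_eigenspaces[OF assms(1) _ Rl]
  note sub = csubspace_F_iso[OF assms(1) _ Rl]
  show "complex_vector.subspace (F_iso n R k)" if "k \<in> {0..n div 2}" for k
    using that sub by simp
  show "pairwise (\<lambda>j k. \<forall>x\<in>F_iso n R j. \<forall>y\<in>F_iso n R k. cinner x y = 0) {0..n div 2}"
  proof (rule pairwiseI, intro ballI)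
    fix j k x y
    assume jk: "j \<in> {0..n div 2}" "k \<in> {0..n div 2}" "j \<noteq> k"
      and "x \<in> F_iso n R j" "y \<in> F_iso n R k"
    then obtain x1 x2 y1 y2 where
        x: "x = x1 + x2" "x1 \<in> eigenspace R (zeta n ^ j)" "x2 \<in> eigenspace R (inverse (zeta n ^ j))"
      and y: "y = y1 + y2" "y1 \<in> eigenspace R (zeta n ^ k)" "y2 \<in> eigenspace R (inverse (zeta n ^ k))"
      by (auto simp: F)
    have "j < n" "k < n" using jk assms(1) by (auto intro: le_less_trans div_less_dividend)
    then have ne1: "zeta n ^ j \<noteq> zeta n ^ k" using jk zeta_power_eq_iff[OF assms(1)] by simp
    have "0 < j + k" "j + k < n" using jk by auto
    then have "zeta n ^ (j + k) \<noteq> 1" using zeta_power_eq_iff[OF assms(1), of "j + k" 0] by simp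
    then have ne2: "zeta n ^ j \<noteq> inverse (zeta n ^ k)" "inverse (zeta n ^ j) \<noteq> zeta n ^ k"
      by (auto simp: power_add field_simps zeta_nonzero)
    note orth = unitary_eigenspaces_orthogonal[OF R(1)]
    have "norm (zeta n ^ k) = 1" "norm (inverse (zeta n ^ k)) = 1"
      by (simp_all add: norm_power norm_inverse norm_zeta)
    then have "cinner x1 y1 = 0" "cinner x1 y2 = 0" "cinner x2 y1 = 0" "cinner x2 y2 = 0"
      using orth[OF x(2) y(2)] orth[OF x(2) y(3)] orth[OF x(3) y(2)] orth[OF x(3) y(3)] ne1 ne2
      by simp_all
    then show "cinner x y = 0" by (simp add: x y cinner_add_left cinner_add_right)
  qed
  show "\<exists>f. (\<forall>k\<in>{0..n div 2}. f k \<in> F_iso n R k) \<and> x = (\<Sum>k = 0..n div 2. f k)" for x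
  proof -
    define q where "q k = root_projection n R (zeta n ^ k) x" for k
    define \<phi> where "\<phi> k = min k (n - k)" for k
    define f where "f i = (\<Sum>k\<in>{k\<in>{..<n}. \<phi> k = i}. q k)" for i
    have q: "q k \<in> eigenspace R (zeta n ^ k)" for k
    proof -
      have "zeta n ^ n = 1" using zeta_power_eq_iff[OF assms(1), of n 0] by simp
      then have "(zeta n ^ k) ^ n = 1" by (metis power_mult mult.commute power_one)
      then show ?thesis unfolding q_def by (rule root_projection_in_eigenspace[OF Rl R(2)])
    qed
    have zero: "0 \<in> eigenspace R w" for w
      by (rule complex_vector.subspace_0[OF csubspace_eigenspace[OF Rl]])
    have "f i \<in> F_iso n R i" if i: "i \<in> {0..n div 2}" for i
      unfolding f_def
    proof (rule complex_vector.subspace_sum[OF sub])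
      fix k assume "k \<in> {k\<in>{..<n}. \<phi> k = i}"
      then have k: "k < n" "i = k \<or> i = n - k" by (auto simp: \<phi>_def min_def split: if_splits)
      then have "q k \<in> eigenspace R (zeta n ^ i) \<or> q k \<in> eigenspace R (inverse (zeta n ^ i))"
        using q[of k] zeta_power_mirror[OF assms(1), of k] by auto
      moreover have "u + v \<in> F_iso n R i"
        if "u \<in> eigenspace R (zeta n ^ i)" "v \<in> eigenspace R (inverse (zeta n ^ i))" for u v
        using that i by (auto simp: F)
      from this[of "q k" 0] this[of 0 "q k"] have "q k \<in> F_iso n R i"
        if "q k \<in> eigenspace R (zeta n ^ i) \<or> q k \<in> eigenspace R (inverse (zeta n ^ i))"
        using that zero by auto
      ultimately show "q k \<in> F_iso n R i" by blast
    qed (use i in simp)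
    moreover have "x = (\<Sum>i = 0..n div 2. f i)"
    proof -
      have "(\<Sum>i = 0..n div 2. f i) = (\<Sum>k<n. q k)"
        unfolding f_def by (rule sum.group) (auto simp: \<phi>_def)
      then show ?thesis unfolding q_def sum_root_projections[OF assms(1)] by simp
    qed
    ultimately show ?thesis by blast
  qed
qed auto

section \<open>Reflections\<close>

lemma dihedral_conjugation:
  assumes "dihedral_rep n R S"
  shows "S (S x) = x" "R (S (R x)) = S x"
proof -
  have "(S ^^ 2) x = x" "((S \<circ> R) ^^ 2) (x::'a) = x" for x
    using assms by (simp_all add: dihedral_rep_def)
  then have *: "S (S x) = x" "S (R (S (R x))) = x" for x by (simp_all add: numeral_2_eq_2)
  show "S (S x) = x" by (rule *)
  have "R (S (R x)) = S (S (R (S (R x))))" by (simp only: *(1))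
  also have "\<dots> = S x" by (simp only: *(2))
  finally show "R (S (R x)) = S x" .
qed

text \<open>The relation \<open>R (S (R x)) = S x\<close> cancels the powers of \<open>R\<close> around the inner \<open>S\<close> in pairs.\<close>

lemma reflection_involution:
  assumes "dihedral_rep n R S"
  shows "S ((R ^^ h) (S ((R ^^ h) x))) = x"
proof -
  have "(R ^^ h) (S ((R ^^ h) x)) = S x"
  proof (induction h)
    case (Suc h)
    have "(R ^^ Suc h) (S ((R ^^ Suc h) x)) = (R ^^ h) (R (S (R ((R ^^ h) x))))"
      by (simp only: funpow_Suc_right comp_apply) (simp only: funpow_swap1)
    then show ?case using Suc by (simp add: dihedral_conjugation(2)[OF assms])
  qed simp
  then show ?thesis by (simp add: dihedral_conjugation(1)[OF assms])
qed

lemma reflection_unitary: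
  assumes "dihedral_rep n R S"
  shows "unitary (\<lambda>x. S ((R ^^ h) x))"
  by (rule unitary_compose[OF _ unitary_funpow]) (use assms in \<open>simp_all add: dihedral_rep_def\<close>)

text \<open>A reflection conjugates \<open>R\<close> to its inverse.\<close>

lemma reflection_eigenspace:
  assumes rep: "dihedral_rep n R S" and x: "x \<in> eigenspace R w" and "w \<noteq> 0"
  shows "S ((R ^^ h) x) \<in> eigenspace R (inverse w)"
proof -
  let ?U = "\<lambda>x. S ((R ^^ h) x)"
  have U: "bounded_clinear ?U" and R: "bounded_clinear R"
    using reflection_unitary[OF rep, of h] rep by (simp_all add: unitary_def dihedral_rep_def)
  have "?U x = R (S (R ((R ^^ h) x)))" by (simp only: dihedral_conjugation(2)[OF rep])
  also have "\<dots> = R (?U (R x))" by (simp only: funpow_swap1)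
  also have "\<dots> = w *\<^sub>C R (?U x)"
    using x by (simp add: eigenspace_def bounded_clinearD(3)[OF U] bounded_clinearD(3)[OF R])
  finally have "inverse w *\<^sub>C ?U x = inverse w *\<^sub>C w *\<^sub>C R (?U x)" by simp
  then show ?thesis using \<open>w \<noteq> 0\<close> by (simp add: eigenspace_def scaleC_scaleC)
qed

lemma reflection_F_iso:
  assumes rep: "dihedral_rep n R S" and n: "n \<ge> 1" and k: "k \<le> n div 2" and x: "x \<in> F_iso n R k"
  shows "S ((R ^^ h) x) \<in> F_iso n R k"
proof -
  have U: "bounded_clinear (\<lambda>x. S ((R ^^ h) x))" and R: "bounded_clinear R"
    using reflection_unitary[OF rep, of h] rep by (simp_all add: unitary_def dihedral_rep_def)
  note F = F_iso_eq_sum_eigenspaces[OF n k R]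
  obtain a b where ab: "x = a + b" "a \<in> eigenspace R (zeta n ^ k)" "b \<in> eigenspace R (inverse (zeta n ^ k))"
    using x unfolding F by blast
  have "S ((R ^^ h) b) \<in> eigenspace R (zeta n ^ k)" "S ((R ^^ h) a) \<in> eigenspace R (inverse (zeta n ^ k))"
    using reflection_eigenspace[OF rep ab(3)] reflection_eigenspace[OF rep ab(2)] zeta_nonzero[of n] by auto
  moreover have "S ((R ^^ h) x) = S ((R ^^ h) b) + S ((R ^^ h) a)"
    using bounded_clinearD(1)[OF U] ab(1) by (simp add: add.commute)
  ultimately show ?thesis unfolding F by blast
qed

text \<open>Each \<open>x\<close> is the mean of \<open>x + U x\<close> and \<open>x - U x\<close>, which are eigenvectors if not zero.\<close>

lemma involution_decomposition:
  assumes U: "unitary U" and inv: "\<And>x. U (U x) = x"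
  shows "orthogonal_decomposition {1, -1::real} (\<lambda>s. {x. U x = s *\<^sub>R x}) UNIV"
  unfolding orthogonal_decomposition_def
proof (intro conjI ballI)
  have Ul: "bounded_clinear U" using U by (simp add: unitary_def)
  have eq: "{x. U x = s *\<^sub>R x} = eigenspace U (of_real s)" for s :: real
    by (simp add: eigenspace_def scaleR_scaleC)
  show "complex_vector.subspace {x. U x = s *\<^sub>R x}" for s
    unfolding eq by (rule csubspace_eigenspace[OF Ul])
  show "pairwise (\<lambda>s t. \<forall>x\<in>{x. U x = s *\<^sub>R x}. \<forall>y\<in>{x. U x = t *\<^sub>R x}. cinner x y = 0) {1, -1::real}"
    unfolding eq pairwise_def using unitary_eigenspaces_orthogonal[OF U] by auto
  show "\<exists>f. (\<forall>s\<in>{1, -1}. f s \<in> {x. U x = s *\<^sub>R x}) \<and> x = (\<Sum>s\<in>{1, -1::real}. f s)" for x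
  proof (intro exI conjI)
    let ?f = "\<lambda>s. (1/2) *\<^sub>R (x + s *\<^sub>R U x)"
    show "\<forall>s\<in>{1, -1}. ?f s \<in> {x. U x = s *\<^sub>R x}"
      by (auto simp: bounded_clinearD[OF Ul] inv bounded_clinearD(4)[OF Ul, of "-1", simplified] algebra_simps)
    show "x = (\<Sum>s\<in>{1, -1::real}. ?f s)"
      by (simp add: scaleR_add_right[symmetric] scaleR_2[symmetric])
  qed
qed auto

text \<open>
  An operator that preserves the summands acts on components, and these are unique; so the components
  of an eigenvector are eigenvectors.
\<close>

lemma orthogonal_decomposition_eigenvectors:
  assumes dec: "orthogonal_decomposition I F UNIV" and U: "bounded_clinear U"
    and inv: "\<And>i x. i \<in> I \<Longrightarrow> x \<in> F i \<Longrightarrow> U x \<in> F i"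
  shows "orthogonal_decomposition I (\<lambda>i. {x \<in> F i. U x = s *\<^sub>R x}) {x. U x = s *\<^sub>R x}"
  unfolding orthogonal_decomposition_def
proof (intro conjI ballI)
  have fin: "finite I" and sub: "\<And>i. i \<in> I \<Longrightarrow> complex_vector.subspace (F i)"
    and pw: "pairwise (\<lambda>i j. \<forall>x\<in>F i. \<forall>y\<in>F j. cinner x y = 0) I"
    using dec by (auto simp: orthogonal_decomposition_def)
  show "finite I" by (rule fin)
  show "complex_vector.subspace {x \<in> F i. U x = s *\<^sub>R x}" if "i \<in> I" for i
  proof -
    have "{x \<in> F i. U x = s *\<^sub>R x} = F i \<inter> eigenspace U (of_real s)"
      by (auto simp: eigenspace_def scaleR_scaleC)
    then show ?thesis
      using complex_vector.subspace_inter[OF sub[OF that] csubspace_eigenspace[OF U]] by simp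
  qed
  show "pairwise (\<lambda>i j. \<forall>x\<in>{x \<in> F i. U x = s *\<^sub>R x}. \<forall>y\<in>{x \<in> F j. U x = s *\<^sub>R x}. cinner x y = 0) I"
    using pw by (auto simp: pairwise_def)
  show "\<exists>f. (\<forall>i\<in>I. f i \<in> {x \<in> F i. U x = s *\<^sub>R x}) \<and> x = (\<Sum>i\<in>I. f i)"
    if x: "x \<in> {x. U x = s *\<^sub>R x}" for x
  proof -
    have "\<exists>f. (\<forall>i\<in>I. f i \<in> F i) \<and> x = (\<Sum>i\<in>I. f i)"
      using dec by (simp add: orthogonal_decomposition_def)
    then obtain f where f: "\<And>i. i \<in> I \<Longrightarrow> f i \<in> F i" "x = (\<Sum>i\<in>I. f i)"
      by blast
    define d where "d i = U (f i) - s *\<^sub>R f i" for i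
    have dF: "d i \<in> F i" if "i \<in> I" for i
      unfolding d_def using f(1) inv sub that
      by (intro complex_vector.subspace_diff csubspace_scaleR) auto
    have "(\<Sum>i\<in>I. d i) = U x - s *\<^sub>R x"
      unfolding d_def f(2) sum_subtractf bounded_clinearD(5)[OF U] scaleR_sum_right ..
    also have "\<dots> = 0" using x by simp
    finally have 0: "(\<Sum>i\<in>I. d i) = 0" .
    have "pairwise (\<lambda>i j. cinner (d i) (d j) = 0) I"
      using pw dF by (auto simp: pairwise_def)
    then have "d i = 0" if "i \<in> I" for i using orthogonal_sum_eq_0[OF fin _ 0 that] by blast
    then show ?thesis using f by (intro exI[of _ f]) (auto simp: d_def)
  qed
qed auto

lemma F_refl_decomposition:
  assumes "dihedral_rep n R S" "n \<ge> 1"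
  shows "orthogonal_decomposition {0..n div 2} (\<lambda>k. F_refl n R S k h s) (E_refl R S h s)"
  unfolding F_refl_def E_refl_def
  using assms reflection_unitary[OF assms(1), of h] reflection_F_iso[OF assms]
  by (intro orthogonal_decomposition_eigenvectors F_iso_decomposition)
    (auto simp: dihedral_rep_def unitary_def)

section \<open>Equivariant operators\<close>

lemma F_iso_invariant:
  assumes n: "n \<ge> 1" "k \<le> n div 2" and R: "bounded_clinear R" and A: "bounded_clinear A"
    and comm: "\<And>x. A (R x) = R (A x)"
  shows "A ` F_iso n R k \<subseteq> F_iso n R k"
proof -
  have "A x \<in> eigenspace R w" if "x \<in> eigenspace R w" for x w
    using that by (simp add: eigenspace_def comm[symmetric] bounded_clinearD[OF A])
  then show ?thesis
    unfolding F_iso_eq_sum_eigenspaces[OF n R] using bounded_clinearD(1)[OF A] by blast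
qed

theorem corollary1:
  fixes n :: nat
    and R S A K :: "'a::chilbert_space \<Rightarrow> 'a"
  assumes "n \<ge> 1"
    and separable: "\<exists>D::'a set. countable D \<and> closure D = UNIV"
    and rep: "dihedral_rep n R S"
    and A: "essentially_positive A"
    and K: "compact_operator K" "selfadjoint K"
    and equivariant: "\<forall>t\<in>{0..1::real}. \<forall>x.
          A (R x) + t *\<^sub>R K (R x) = R (A x + t *\<^sub>R K x) \<and>
          A (S x) + t *\<^sub>R K (S x) = S (A x + t *\<^sub>R K x)"
  shows "\<forall>h<n.
      morse_index UNIV A = morse_index (E_refl R S h 1) A + morse_index (E_refl R S h (-1)) A \<and>
      (\<forall>s\<in>{1, -1}. morse_index (E_refl R S h s) A =
         (\<Sum>k = 0..n div 2. morse_index (F_refl n R S k h s) A))"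
proof (intro allI impI conjI ballI)
  fix h
  let ?U = "\<lambda>x. S ((R ^^ h) x)"
  have comm: "A (R x) = R (A x)" "A (S x) = S (A x)" for x
    using equivariant[rule_format, of 0 x] by simp_all
  have comm_pow: "A ((R ^^ h) x) = (R ^^ h) (A x)" for x by (induction h) (simp_all add: comm)
  have sa: "selfadjoint A" using A by (simp add: essentially_positive_def)
  have Al: "bounded_clinear A" using sa by (simp add: selfadjoint_def)
  have Rl: "bounded_clinear R" using rep by (simp add: dihedral_rep_def unitary_def)
  have E_inv: "A ` E_refl R S h s \<subseteq> E_refl R S h s" for s
    by (auto simp: E_refl_def comm_pow[symmetric] comm(2)[symmetric] bounded_clinearD(4)[OF Al])
  have E_dec: "orthogonal_decomposition {1, -1} (E_refl R S h) UNIV"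
    using involution_decomposition[OF reflection_unitary[OF rep] reflection_involution[OF rep]]
    by (simp add: E_refl_def[abs_def])
  have "morse_index UNIV A = (\<Sum>s\<in>{1, -1}. morse_index (E_refl R S h s) A)"
    by (rule morse_index_orthogonal_decomposition[OF A _ E_dec E_inv]) (simp add: closed_invariant_def)
  then show "morse_index UNIV A = morse_index (E_refl R S h 1) A + morse_index (E_refl R S h (-1)) A"
    by simp
  fix s :: real assume s: "s \<in> {1, -1}"
  have "complex_vector.subspace (E_refl R S h s)"
    using E_dec s unfolding orthogonal_decomposition_def by blast
  then have "closed_invariant A (E_refl R S h s)"
    using orthogonal_decomposition_closed[OF E_dec closed_UNIV s] E_inv
    by (simp add: closed_invariant_def)
  then show "morse_index (E_refl R S h s) A = (\<Sum>k = 0..n div 2. morse_index (F_refl n R S k h s) A)"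
  proof (rule morse_index_orthogonal_decomposition[OF A _ F_refl_decomposition[OF rep \<open>n \<ge> 1\<close>]])
    fix k assume "k \<in> {0..n div 2}"
    then show "A ` F_refl n R S k h s \<subseteq> F_refl n R S k h s"
      using F_iso_invariant[OF \<open>n \<ge> 1\<close> _ Rl Al comm(1)] E_inv[of s]
      by (fastforce simp: F_refl_def E_refl_def)
  qed
qed

end
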